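(* Let $(X,d)$ be a u.l.f. metric space, $h\colon X\to\mathbb{R}$ a coarse map, and $\beta\in\mathbb{R}$. (1) Any extreme $(\sigma_h,\beta)$-KMS state on $\mathrm{C}^*_u(X)$ which vanishes on the compact operators is supported on some element of $\nu X$. (2) If there is a $(\sigma_h,\beta)$-KMS state on $\mathrm{C}^*_u(X)$ which vanishes on the compact operators and whose induced state on $\mathrm{Q}^*_u(X)$ is faithful on $C(\nu X)$, then for every $x\in\nu X$ there is a $(\sigma_h,\beta)$-KMS state on $\mathrm{C}^*_u(X)$ supported on $x$.
   Context: A metric space is u.l.f. if for every $r>0$ the cardinalities of its balls of radius $r$ are uniformly bounded. $\mathrm{C}^*_u(X)$ is the norm closure of the $^*$-algebra of operators $a$ on $\ell_2(X)$ with $\sup\{d(x,y):\langle a\delta_y,\delta_x\rangle\neq0\}<\infty$; $\ell_\infty(X)$ is identified with the diagonal operators, and for $A\subseteq X$, $\chi_A$ is the projection onto $\ell_2(A)$. $h$ is coarse if for each $r>0$ there is $s>0$ with $d(x,y)<r\Rightarrow|h(x)-h(y)|<s$. $\sigma_{h,t}(a)=e^{it\bar h}ae^{-it\bar h}$, $e^{it\bar h}\delta_x=e^{ith(x)}\delta_x$. A state $\varphi$ is $(\sigma_h,\beta)$-KMS if $\varphi(a\sigma_{h,i\beta}(b))=\varphi(ba)$ for all $a$ and all analytic $b$ (those for which $t\mapsto\sigma_{h,t}(b)$ extends to an entire function); extreme means an extreme point of the convex set of such states. $\mathrm{Q}^*_u(X)=\mathrm{C}^*_u(X)/\mathcal{K}(\ell_2(X))$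 with quotient map $\pi$; a state vanishing on compacts induces a state $\psi$ on $\mathrm{Q}^*_u(X)$ with $\psi\circ\pi=\varphi$. Higson functions: bounded $f\colon X\to\mathbb{C}$ such that for all $\varepsilon,R>0$ there is finite $F$ with $|f(x)-f(y)|<\varepsilon$ whenever $x,y\notin F$, $d(x,y)<R$; they form $C_h(X)\subseteq\ell_\infty(X)$ with spectrum $hX$ (Higson compactification, containing $X$ as a dense subset), $\nu X=hX\setminus X$, and $C(\nu X)\cong C_h(X)/c_0(X)\subseteq\mathrm{Q}^*_u(X)$. A state $\varphi$ on $\mathrm{C}^*_u(X)$ is supported on $x\in\nu X$ if $\varphi(\chi_{U\cap X})=1$ for every neighborhood $U\subseteq hX$ of $x$. *)

theory Defs
  imports "HOL-Analysis.Analysis"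
begin

text \<open>Bounded operators on l2(X) are represented by their matrices
  a x y = <a delta_y, delta_x>.  The metric space X is the universe of a type
  of class metric_space.\<close>

type_synonym 'a mat = "'a \<Rightarrow> 'a \<Rightarrow> complex"

definition fsupp :: "('a \<Rightarrow> complex) \<Rightarrow> bool" where
  "fsupp v \<longleftrightarrow> finite {x. v x \<noteq> 0}"

definition l2norm :: "('a \<Rightarrow> complex) \<Rightarrow> real" where
  "l2norm v = sqrt (\<Sum>x\<in>{x. v x \<noteq> 0}. (cmod (v x))\<^sup>2)"

definition bilin :: "'a mat \<Rightarrow> ('a \<Rightarrow> complex) \<Rightarrow> ('a \<Rightarrow> complex) \<Rightarrow> complex" where
  "bilin a v w = (\<Sum>x\<in>{x. v x \<noteq> 0}. \<Sum>y\<in>{y. w y \<noteq> 0}. cnj (v x) * a x y * w y)"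

definition op_vals :: "'a mat \<Rightarrow> real set" where
  "op_vals a = {cmod (bilin a v w) | v w. fsupp v \<and> fsupp w \<and> l2norm v \<le> 1 \<and> l2norm w \<le> 1}"

definition bounded_op :: "'a mat \<Rightarrow> bool" where
  "bounded_op a \<longleftrightarrow> bdd_above (op_vals a)"

definition opnorm :: "'a mat \<Rightarrow> real" where
  "opnorm a = Sup (op_vals a)"

definition madd :: "'a mat \<Rightarrow> 'a mat \<Rightarrow> 'a mat" where
  "madd a b = (\<lambda>x y. a x y + b x y)"

definition msub :: "'a mat \<Rightarrow> 'a mat \<Rightarrow> 'a mat" where
  "msub a b = (\<lambda>x y. a x y - b x y)"

definition mscale :: "complex \<Rightarrow> 'a mat \<Rightarrow> 'a mat" where
  "mscale c a = (\<lambda>x y. c * a x y)"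

definition mmult :: "'a mat \<Rightarrow> 'a mat \<Rightarrow> 'a mat" where
  "mmult a b = (\<lambda>x y. infsum (\<lambda>z. a x z * b z y) UNIV)"

definition madj :: "'a mat \<Rightarrow> 'a mat" where
  "madj a = (\<lambda>x y. cnj (a y x))"

definition mone :: "'a mat" where
  "mone = (\<lambda>x y. if x = y then 1 else 0)"

definition diag :: "('a \<Rightarrow> complex) \<Rightarrow> 'a mat" where
  "diag f = (\<lambda>x y. if x = y then f x else 0)"

definition chi :: "'a set \<Rightarrow> 'a mat" where
  "chi A = diag (\<lambda>x. if x \<in> A then 1 else 0)"

definition finite_prop :: "('a::metric_space) mat \<Rightarrow> bool" where
  "finite_prop a \<longleftrightarrow> (\<exists>R. \<forall>x y. a x y \<noteq> 0 \<longrightarrow> dist x y \<le> R)"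

definition roe :: "('a::metric_space) mat set" where
  "roe = {a. bounded_op a \<and>
     (\<forall>\<epsilon>>0. \<exists>b. bounded_op b \<and> finite_prop b \<and> opnorm (msub a b) < \<epsilon>)}"

text \<open>Compact operators on l2(X): norm closure of the finite-rank operators, which
  equals the norm closure of the finitely supported matrices.\<close>
definition compacts :: "'a mat set" where
  "compacts = {a. bounded_op a \<and>
     (\<forall>\<epsilon>>0. \<exists>b. finite {(x,y). b x y \<noteq> 0} \<and> opnorm (msub a b) < \<epsilon>)}"

definition ulf :: "'a::metric_space itself \<Rightarrow> bool" where
  "ulf _ \<longleftrightarrow> (\<forall>r>0. \<exists>N::nat. \<forall>x::'a. finite (ball x r) \<and> card (ball x r) \<le> N)"

definition coarse :: "('a::metric_space \<Rightarrow> real) \<Rightarrow> bool" where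
  "coarse h \<longleftrightarrow> (\<forall>r>0. \<exists>s>0. \<forall>x y. dist x y < r \<longrightarrow> \<bar>h x - h y\<bar> < s)"

definition sigma :: "('a \<Rightarrow> real) \<Rightarrow> real \<Rightarrow> 'a mat \<Rightarrow> 'a mat" where
  "sigma h t a = (\<lambda>x y. exp (\<i> * of_real (t * h x)) * a x y * exp (- \<i> * of_real (t * h y)))"

definition entire_ext :: "('a::metric_space \<Rightarrow> real) \<Rightarrow> 'a mat \<Rightarrow> (complex \<Rightarrow> 'a mat) \<Rightarrow> bool" where
  "entire_ext h b F \<longleftrightarrow>
     (\<forall>z. F z \<in> roe) \<and>
     (\<forall>t::real. F (of_real t) = sigma h t b) \<and>
     (\<forall>z. \<exists>D\<in>roe. ((\<lambda>w. opnorm (msub (msub (F w) (F z)) (mscale (w - z) D)) / cmod (w - z))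
                    \<longlongrightarrow> 0) (at z))"

definition is_state :: "('a::metric_space mat \<Rightarrow> complex) \<Rightarrow> bool" where
  "is_state \<phi> \<longleftrightarrow>
     (\<forall>a\<in>roe. \<forall>b\<in>roe. \<phi> (madd a b) = \<phi> a + \<phi> b) \<and>
     (\<forall>a\<in>roe. \<forall>c. \<phi> (mscale c a) = c * \<phi> a) \<and>
     (\<forall>a\<in>roe. \<phi> (mmult (madj a) a) \<in> \<real> \<and> Re (\<phi> (mmult (madj a) a)) \<ge> 0) \<and>
     \<phi> mone = 1"

text \<open>(sigma_h, beta)-KMS state; sigma_{h,i beta}(b) is the value at i beta of the entire
  extension F.\<close>
definition is_KMS :: "('a::metric_space \<Rightarrow> real) \<Rightarrow> real \<Rightarrow> ('a mat \<Rightarrow> complex) \<Rightarrow> bool" where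
  "is_KMS h \<beta> \<phi> \<longleftrightarrow> is_state \<phi> \<and>
     (\<forall>a\<in>roe. \<forall>b\<in>roe. \<forall>F. entire_ext h b F \<longrightarrow>
        \<phi> (mmult a (F (\<i> * of_real \<beta>))) = \<phi> (mmult b a))"

text \<open>Extreme point of the convex set of KMS states (states identified on C*_u(X)).\<close>
definition is_extreme_KMS :: "('a::metric_space \<Rightarrow> real) \<Rightarrow> real \<Rightarrow> ('a mat \<Rightarrow> complex) \<Rightarrow> bool" where
  "is_extreme_KMS h \<beta> \<phi> \<longleftrightarrow> is_KMS h \<beta> \<phi> \<and>
     (\<forall>\<phi>1 \<phi>2 (s::real). is_KMS h \<beta> \<phi>1 \<and> is_KMS h \<beta> \<phi>2 \<and> 0 < s \<and> s < 1 \<and>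
        (\<forall>a\<in>roe. \<phi> a = of_real s * \<phi>1 a + of_real (1 - s) * \<phi>2 a) \<longrightarrow>
        (\<forall>a\<in>roe. \<phi>1 a = \<phi> a \<and> \<phi>2 a = \<phi> a))"

definition vanishes_on_compacts :: "('a::metric_space mat \<Rightarrow> complex) \<Rightarrow> bool" where
  "vanishes_on_compacts \<phi> \<longleftrightarrow> (\<forall>k\<in>compacts. \<phi> k = 0)"

definition higson :: "('a::metric_space \<Rightarrow> complex) set" where
  "higson = {f. bounded (range f) \<and>
     (\<forall>\<epsilon>>0. \<forall>R>0. \<exists>F. finite F \<and>
        (\<forall>x y. x \<notin> F \<and> y \<notin> F \<and> dist x y < R \<longrightarrow> cmod (f x - f y) < \<epsilon>))}"

text \<open>Points of hX = characters of C_h(X) (normalised to vanish outside C_h(X)).\<close>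
definition hX :: "(('a::metric_space \<Rightarrow> complex) \<Rightarrow> complex) set" where
  "hX = {\<omega>. (\<forall>f. f \<notin> higson \<longrightarrow> \<omega> f = 0) \<and>
     (\<forall>f\<in>higson. \<forall>g\<in>higson. \<omega> (\<lambda>x. f x + g x) = \<omega> f + \<omega> g) \<and>
     (\<forall>f\<in>higson. \<forall>c. \<omega> (\<lambda>x. c * f x) = c * \<omega> f) \<and>
     (\<forall>f\<in>higson. \<forall>g\<in>higson. \<omega> (\<lambda>x. f x * g x) = \<omega> f * \<omega> g) \<and>
     \<omega> (\<lambda>x. 1) = 1}"

definition ev :: "'a::metric_space \<Rightarrow> (('a \<Rightarrow> complex) \<Rightarrow> complex)" where
  "ev p = (\<lambda>f. if f \<in> higson then f p else 0)"

definition nuX :: "(('a::metric_space \<Rightarrow> complex) \<Rightarrow> complex) set" where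
  "nuX = hX - range ev"

definition hX_nhd :: "(('a::metric_space \<Rightarrow> complex) \<Rightarrow> complex) \<Rightarrow> (('a \<Rightarrow> complex) \<Rightarrow> complex) set \<Rightarrow> bool" where
  "hX_nhd \<omega> U \<longleftrightarrow> U \<subseteq> hX \<and> (\<exists>F \<epsilon>. finite F \<and> F \<subseteq> higson \<and> \<epsilon> > 0 \<and>
      {\<eta>\<in>hX. \<forall>f\<in>F. cmod (\<eta> f - \<omega> f) < \<epsilon>} \<subseteq> U)"

definition supported_on :: "('a::metric_space mat \<Rightarrow> complex) \<Rightarrow> (('a \<Rightarrow> complex) \<Rightarrow> complex) \<Rightarrow> bool" where
  "supported_on \<phi> \<omega> \<longleftrightarrow> (\<forall>U. hX_nhd \<omega> U \<longrightarrow> \<phi> (chi {p. ev p \<in> U}) = 1)"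

text \<open>The induced state psi on Q*_u(X) is faithful on C(nu X) = C_h(X)/c_0(X):
  a positive element of C(nu X) is pi(diag f) with f in C_h(X) and omega(f) >= 0 on nu X;
  psi(pi(diag f)) = phi(diag f); and pi(diag f) = 0 iff omega(f) = 0 for all omega in nu X.\<close>
definition faithful_on_CnuX :: "('a::metric_space mat \<Rightarrow> complex) \<Rightarrow> bool" where
  "faithful_on_CnuX \<phi> \<longleftrightarrow> (\<forall>f\<in>higson.
     (\<forall>\<omega>\<in>nuX. \<omega> f \<in> \<real> \<and> Re (\<omega> f) \<ge> 0) \<and> \<phi> (diag f) = 0 \<longrightarrow> (\<forall>\<omega>\<in>nuX. \<omega> f = 0))"

end

theory Submission
  imports Defs
begin

text \<open>Higson functions commute with the uniform Roe algebra modulo the compacts. Hence, for a KMS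
  state \<phi> vanishing on the compacts and a Higson function f \<ge> 0 with \<phi>(f) > 0, the functional
  a \<mapsto> \<phi>(f a) / \<phi>(f) is again a KMS state.

  If \<phi> is extreme, writing it as a convex combination of the states obtained from f and 1 - f
  gives \<phi>(f a) = \<phi>(f) \<phi>(a); so \<phi> restricts to a character of the Higson functions, which is
  the point supporting \<phi>. If instead the induced state is faithful on the corona, one takes for
  f Higson functions supported in smaller and smaller neighbourhoods of the given point and passes
  to a limit in the product topology. Compactness needs states to be contractive for the operator
  norm, which follows from the binomial series for sqrt (1 - x) in the Banach algebra of bounded
  operators.\<close>

section \<open>Bounded matrices\<close>

text \<open>A state is given only by linearity and positivity on \<open>roe\<close>, so its
  continuity must be earned before any limit can be taken. The square root behind it has to lie in
  the Roe algebra itself, where positivity is assumed; hence a power series in a Banach algebra,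
  which requires an associative matrix product and a complete operator norm, and these occupy the
  first half. The reweighted functional is positive because the weight is written as a square
  \<open>G * G\<close>: modulo compacts, \<open>G * G * adj a * a\<close> may be replaced by
  \<open>adj (a * G) * (a * G)\<close>. For an extreme state the weight is kept between 1/3 and 2/3,
  so that neither it nor its complement has value 0; linear combinations then reach all Higson
  functions. In the second part, faithfulness makes the value of the weight nonzero. The limit is
  harmless: being KMS, and having value exactly 1 on the projection of a neighbourhood, are
  equations and inequalities between values at fixed operators, hence closed under pointwise
  limits.\<close>

text \<open>Bounds the operator norm by \<^term>\<open>C\<close>; unlike \<^const>\<open>opnorm\<close>, a supremum, it has no junk
  value on unbounded matrices.\<close>
definition opbd :: "'a mat \<Rightarrow> real \<Rightarrow> bool" where
  "opbd a C \<longleftrightarrow> 0 \<le> C \<and> (\<forall>S T w. finite S \<longrightarrow> finite T \<longrightarrow>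
     L2_set (\<lambda>x. cmod (\<Sum>y\<in>T. a x y * w y)) S \<le> C * L2_set (\<lambda>y. cmod (w y)) T)"

lemma opbdD:
  assumes "opbd a C" "finite S" "finite T"
  shows "L2_set (\<lambda>x. cmod (\<Sum>y\<in>T. a x y * w y)) S \<le> C * L2_set (\<lambda>y. cmod (w y)) T"
  using assms unfolding opbd_def by blast

lemma opbd_nonneg: "opbd a C \<Longrightarrow> 0 \<le> C"
  unfolding opbd_def by blast

lemma opbd_bilinear:
  assumes "opbd a C" "finite S" "finite T"
  shows "cmod (\<Sum>x\<in>S. \<Sum>y\<in>T. cnj (v x) * a x y * w y)
    \<le> C * L2_set (\<lambda>x. cmod (v x)) S * L2_set (\<lambda>y. cmod (w y)) T"
proof -
  have "cmod (\<Sum>x\<in>S. \<Sum>y\<in>T. cnj (v x) * a x y * w y)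
      = cmod (\<Sum>x\<in>S. cnj (v x) * (\<Sum>y\<in>T. a x y * w y))"
    by (simp add: sum_distrib_left mult.assoc)
  also have "\<dots> \<le> (\<Sum>x\<in>S. \<bar>cmod (v x)\<bar> * \<bar>cmod (\<Sum>y\<in>T. a x y * w y)\<bar>)"
    by (rule order_trans[OF norm_sum]) (simp add: norm_mult)
  also have "\<dots> \<le> L2_set (\<lambda>x. cmod (v x)) S * L2_set (\<lambda>x. cmod (\<Sum>y\<in>T. a x y * w y)) S"
    by (rule L2_set_mult_ineq)
  also have "\<dots> \<le> L2_set (\<lambda>x. cmod (v x)) S * (C * L2_set (\<lambda>y. cmod (w y)) T)"
    by (intro mult_left_mono opbdD[OF assms] L2_set_nonneg)
  finally show ?thesis by (simp add: mult_ac)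
qed

text \<open>Duality: testing with \<open>v\<close> equal to the image of \<open>w\<close> turns the
  form into the squared length of that image, and one factor of this length cancels. Adjoints and
  band matrices are easier to bound through the form.\<close>

lemma opbdI_bilinear:
  assumes "0 \<le> C"
    and "\<And>S T v w. finite S \<Longrightarrow> finite T \<Longrightarrow> cmod (\<Sum>x\<in>S. \<Sum>y\<in>T. cnj (v x) * a x y * w y)
      \<le> C * L2_set (\<lambda>x. cmod (v x)) S * L2_set (\<lambda>y. cmod (w y)) T"
  shows "opbd a C"
  unfolding opbd_def
proof (intro conjI allI impI)
  fix S T :: "'a set" and w :: "'a \<Rightarrow> complex"
  assume fin: "finite S" "finite T"
  define v where "v x = (\<Sum>y\<in>T. a x y * w y)" for x
  let ?V = "L2_set (\<lambda>x. cmod (v x)) S"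
  have "complex_of_real (?V\<^sup>2) = (\<Sum>x\<in>S. cnj (v x) * v x)"
    by (simp add: L2_set_def sum_nonneg complex_norm_square mult.commute del: of_real_power)
  also have "\<dots> = (\<Sum>x\<in>S. \<Sum>y\<in>T. cnj (v x) * a x y * w y)"
    by (simp add: v_def sum_distrib_left mult.assoc)
  finally have "?V\<^sup>2 = cmod (\<Sum>x\<in>S. \<Sum>y\<in>T. cnj (v x) * a x y * w y)"
    by (metis norm_of_real abs_of_nonneg zero_le_power2)
  also have "\<dots> \<le> C * ?V * L2_set (\<lambda>y. cmod (w y)) T"
    by (rule assms(2)[OF fin])
  finally have "?V * ?V \<le> ?V * (C * L2_set (\<lambda>y. cmod (w y)) T)"
    by (simp add: power2_eq_square mult_ac)
  then show "L2_set (\<lambda>x. cmod (\<Sum>y\<in>T. a x y * w y)) S \<le> C * L2_set (\<lambda>y. cmod (w y)) T"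
    unfolding v_def[symmetric]
    by (cases "?V = 0") (use assms(1) in \<open>auto simp: mult_le_cancel_left_pos order.strict_iff_order\<close>)
qed (rule assms(1))

section \<open>Comparison of \<open>opbd\<close> with the supremum \<open>opnorm\<close>\<close>

lemma sum_supp_eq:
  assumes "finite S" "{x. v x \<noteq> 0} \<subseteq> S" "\<And>x. v x = 0 \<Longrightarrow> g x = 0"
  shows "(\<Sum>x\<in>{x. v x \<noteq> 0}. g x) = (\<Sum>x\<in>S. g x)"
  using assms by (intro sum.mono_neutral_left) auto

lemma l2norm_eq:
  assumes "finite S" "{x. v x \<noteq> 0} \<subseteq> S"
  shows "l2norm v = L2_set (\<lambda>x. cmod (v x)) S"
  unfolding l2norm_def L2_set_def using sum_supp_eq[OF assms, of "\<lambda>x. (cmod (v x))\<^sup>2"] by simp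

lemma bilin_eq:
  assumes "finite S" "{x. v x \<noteq> 0} \<subseteq> S" "finite T" "{x. w x \<noteq> 0} \<subseteq> T"
  shows "bilin a v w = (\<Sum>x\<in>S. \<Sum>y\<in>T. cnj (v x) * a x y * w y)"
proof -
  have "bilin a v w = (\<Sum>x\<in>{x. v x \<noteq> 0}. \<Sum>y\<in>T. cnj (v x) * a x y * w y)"
    unfolding bilin_def by (intro sum.cong refl sum_supp_eq[OF assms(3,4)]) auto
  also have "\<dots> = (\<Sum>x\<in>S. \<Sum>y\<in>T. cnj (v x) * a x y * w y)"
    by (rule sum_supp_eq[OF assms(1,2)]) auto
  finally show ?thesis .
qed

lemma zero_in_op_vals: "0 \<in> op_vals a"
  by (force simp: op_vals_def fsupp_def l2norm_def bilin_def intro!: exI[of _ "\<lambda>_. 0"])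

lemma op_vals_le:
  assumes "opbd a C" "r \<in> op_vals a"
  shows "r \<le> C"
proof -
  obtain v w where r: "r = cmod (bilin a v w)" and f: "fsupp v" "fsupp w"
    and n: "l2norm v \<le> 1" "l2norm w \<le> 1"
    using assms(2) unfolding op_vals_def by blast
  have "r \<le> C * l2norm v * l2norm w"
    using f unfolding r fsupp_def
    by (subst (1 2) l2norm_eq[OF _ order_refl], simp, simp)
       (subst bilin_eq[OF _ order_refl _ order_refl], auto intro!: opbd_bilinear[OF assms(1)])
  also have "\<dots> \<le> C * 1 * 1"
    using n opbd_nonneg[OF assms(1)] by (intro mult_mono) (auto simp: l2norm_def sum_nonneg)
  finally show ?thesis by simp
qed

lemma opbd_imp_bounded_op: "opbd a C \<Longrightarrow> bounded_op a"
  unfolding bounded_op_def bdd_above_def using op_vals_le by blast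

lemma opnorm_le: "opbd a C \<Longrightarrow> opnorm a \<le> C"
  unfolding opnorm_def using op_vals_le zero_in_op_vals by (metis cSup_least empty_iff)

text \<open>The supremum sees only vectors in the unit ball, so arbitrary data on finite sets is cut
  off outside them and rescaled; rescaling fails only for length 0, where the form vanishes.\<close>

lemma opbd_opnorm:
  assumes "bounded_op a"
  shows "opbd a (opnorm a)"
proof (rule opbdI_bilinear)
  show nn: "0 \<le> opnorm a"
    unfolding opnorm_def using assms zero_in_op_vals unfolding bounded_op_def by (rule cSup_upper[rotated])
  fix S T :: "'a set" and v w :: "'a \<Rightarrow> complex"
  assume fin: "finite S" "finite T"
  let ?V = "L2_set (\<lambda>x. cmod (v x)) S" and ?W = "L2_set (\<lambda>y. cmod (w y)) T"
  show "cmod (\<Sum>x\<in>S. \<Sum>y\<in>T. cnj (v x) * a x y * w y) \<le> opnorm a * ?V * ?W"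
  proof (cases "?V = 0 \<or> ?W = 0")
    case True
    then have "(\<Sum>x\<in>S. \<Sum>y\<in>T. cnj (v x) * a x y * w y) = 0"
      using fin by (auto simp: L2_set_eq_0_iff intro!: sum.neutral)
    then show ?thesis using nn by simp
  next
    case False
    then have pos: "?V > 0" "?W > 0" by (auto simp: order.strict_iff_order)
    define v' where "v' x = (if x \<in> S then v x / of_real ?V else 0)" for x
    define w' where "w' x = (if x \<in> T then w x / of_real ?W else 0)" for x
    have s: "{x. v' x \<noteq> 0} \<subseteq> S" "{x. w' x \<noteq> 0} \<subseteq> T" by (auto simp: v'_def w'_def)
    then have f: "fsupp v'" "fsupp w'"
      using fin finite_subset unfolding fsupp_def by blast+
    have L: "L2_set (\<lambda>x. cmod (u x / of_real c)) A = L2_set (\<lambda>x. cmod (u x)) A / c" if "c > 0"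
      for u :: "'a \<Rightarrow> complex" and c A
    proof -
      have "L2_set (\<lambda>x. cmod (u x / of_real c)) A = L2_set (\<lambda>x. cmod (u x) * inverse c) A"
        using that by (intro L2_set_cong) (auto simp: norm_mult norm_inverse divide_inverse)
      then show ?thesis
        using that L2_set_left_distrib[of "inverse c" "\<lambda>x. cmod (u x)" A] by (simp add: divide_inverse)
    qed
    have "l2norm v' = L2_set (\<lambda>x. cmod (v x / of_real ?V)) S"
      unfolding l2norm_eq[OF fin(1) s(1)] by (intro L2_set_cong) (auto simp: v'_def)
    then have n1: "l2norm v' = 1" using pos by (simp add: L)
    have "l2norm w' = L2_set (\<lambda>x. cmod (w x / of_real ?W)) T"
      unfolding l2norm_eq[OF fin(2) s(2)] by (intro L2_set_cong) (auto simp: w'_def)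
    then have n2: "l2norm w' = 1" using pos by (simp add: L)
    have "cmod (bilin a v' w') \<in> op_vals a"
      unfolding op_vals_def using f n1 n2 by (intro CollectI exI[of _ v'] exI[of _ w']) simp
    then have "cmod (bilin a v' w') \<le> opnorm a"
      using assms unfolding opnorm_def bounded_op_def by (rule cSup_upper)
    also have "bilin a v' w' = (\<Sum>x\<in>S. \<Sum>y\<in>T. cnj (v x) * a x y * w y) / (of_real ?V * of_real ?W)"
      unfolding bilin_eq[OF fin(1) s(1) fin(2) s(2)] sum_divide_distrib
      by (intro sum.cong refl) (auto simp: v'_def w'_def)
    finally show ?thesis using pos
      by (simp add: norm_divide norm_mult divide_le_eq mult_ac)
  qed
qed

lemma bounded_op_iff: "bounded_op a \<longleftrightarrow> (\<exists>C. opbd a C)"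
  using opbd_opnorm opbd_imp_bounded_op by blast

lemma opbd_entry:
  assumes "opbd a C"
  shows "cmod (a x y) \<le> C"
  using opbdD[OF assms, of "{x}" "{y}" "\<lambda>_. 1"] by simp

lemma opbd_add:
  assumes "opbd a C" "opbd b D"
  shows "opbd (madd a b) (C + D)"
  unfolding opbd_def
proof (intro conjI allI impI)
  fix S T :: "'a set" and w :: "'a \<Rightarrow> complex"
  assume fin: "finite S" "finite T"
  have "L2_set (\<lambda>x. cmod (\<Sum>y\<in>T. madd a b x y * w y)) S
     \<le> L2_set (\<lambda>x. cmod (\<Sum>y\<in>T. a x y * w y) + cmod (\<Sum>y\<in>T. b x y * w y)) S"
    by (intro L2_set_mono) (auto simp: madd_def algebra_simps sum.distrib norm_triangle_ineq)
  also have "\<dots> \<le> L2_set (\<lambda>x. cmod (\<Sum>y\<in>T. a x y * w y)) S + L2_set (\<lambda>x. cmod (\<Sum>y\<in>T. b x y * w y)) S"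
    by (rule L2_set_triangle_ineq)
  also have "\<dots> \<le> C * L2_set (\<lambda>y. cmod (w y)) T + D * L2_set (\<lambda>y. cmod (w y)) T"
    by (intro add_mono opbdD assms fin)
  finally show "L2_set (\<lambda>x. cmod (\<Sum>y\<in>T. madd a b x y * w y)) S \<le> (C + D) * L2_set (\<lambda>y. cmod (w y)) T"
    by (simp add: algebra_simps)
qed (use opbd_nonneg[OF assms(1)] opbd_nonneg[OF assms(2)] in simp)

lemma opbd_mscale:
  assumes "opbd a C"
  shows "opbd (mscale c a) (cmod c * C)"
  unfolding opbd_def
proof (intro conjI allI impI)
  fix S T :: "'a set" and w :: "'a \<Rightarrow> complex"
  assume fin: "finite S" "finite T"
  have "L2_set (\<lambda>x. cmod (\<Sum>y\<in>T. mscale c a x y * w y)) S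
     = cmod c * L2_set (\<lambda>x. cmod (\<Sum>y\<in>T. a x y * w y)) S"
    by (subst L2_set_right_distrib)
      (auto simp: mscale_def mult.assoc norm_mult[symmetric] sum_distrib_left)
  also have "\<dots> \<le> cmod c * (C * L2_set (\<lambda>y. cmod (w y)) T)"
    by (intro mult_left_mono opbdD assms fin) auto
  finally show "L2_set (\<lambda>x. cmod (\<Sum>y\<in>T. mscale c a x y * w y)) S \<le> cmod c * C * L2_set (\<lambda>y. cmod (w y)) T"
    by (simp add: mult.assoc)
qed (use opbd_nonneg[OF assms] in simp)

lemma opbd_madj:
  assumes "opbd a C"
  shows "opbd (madj a) C"
proof (rule opbdI_bilinear)
  fix S T :: "'a set" and v w :: "'a \<Rightarrow> complex"
  assume fin: "finite S" "finite T"
  have "(\<Sum>x\<in>S. \<Sum>y\<in>T. cnj (v x) * madj a x y * w y)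
      = cnj (\<Sum>y\<in>T. \<Sum>x\<in>S. cnj (w y) * a y x * v x)"
    by (subst sum.swap) (simp add: madj_def mult_ac)
  then have "cmod (\<Sum>x\<in>S. \<Sum>y\<in>T. cnj (v x) * madj a x y * w y)
      = cmod (\<Sum>y\<in>T. \<Sum>x\<in>S. cnj (w y) * a y x * v x)"
    by (metis complex_mod_cnj)
  then show "cmod (\<Sum>x\<in>S. \<Sum>y\<in>T. cnj (v x) * madj a x y * w y)
      \<le> C * L2_set (\<lambda>x. cmod (v x)) S * L2_set (\<lambda>y. cmod (w y)) T"
    using opbd_bilinear[OF assms fin(2,1), of w v] by (simp add: mult_ac)
qed (rule opbd_nonneg[OF assms])

section \<open>Products of bounded matrices\<close>

lemma opbd_column:
  assumes "opbd a C" "finite S"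
  shows "L2_set (\<lambda>x. cmod (a x y)) S \<le> C"
  using opbdD[OF assms, of "{y}" "\<lambda>_. 1"] by simp

lemma opbd_row:
  assumes "opbd a C" "finite T"
  shows "L2_set (\<lambda>y. cmod (a x y)) T \<le> C"
  using opbd_column[OF opbd_madj[OF assms(1)] assms(2), of x] by (simp add: madj_def)

text \<open>Rows and columns of bounded matrices are square summable, so Cauchy-Schwarz bounds all
  finite partial sums. This makes the \<open>infsum\<close> in \<open>mmult\<close> a genuine sum
  and not its default value 0.\<close>

lemma mmult_summable:
  assumes "opbd a C" "opbd b D"
  shows "(\<lambda>z. a x z * b z y) summable_on UNIV"
proof (rule abs_summable_summable, rule nonneg_bdd_above_summable_on)
  have "(\<Sum>z\<in>F. norm (a x z * b z y)) \<le> C * D" if "finite F" for F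
  proof -
    have "(\<Sum>z\<in>F. norm (a x z * b z y)) = (\<Sum>z\<in>F. \<bar>cmod (a x z)\<bar> * \<bar>cmod (b z y)\<bar>)"
      by (simp add: norm_mult)
    also have "\<dots> \<le> L2_set (\<lambda>z. cmod (a x z)) F * L2_set (\<lambda>z. cmod (b z y)) F"
      by (rule L2_set_mult_ineq)
    also have "\<dots> \<le> C * D"
      using assms that by (intro mult_mono opbd_column opbd_row L2_set_nonneg opbd_nonneg)
    finally show ?thesis .
  qed
  then show "bdd_above (sum (\<lambda>z. norm (a x z * b z y)) ` {F. F \<subseteq> UNIV \<and> finite F})"
    by (auto simp: bdd_above_def)
qed auto

lemma mmult_has_sum:
  assumes "opbd a C" "opbd b D"
  shows "((\<lambda>z. a x z * b z y) has_sum mmult a b x y) UNIV"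
  unfolding mmult_def by (rule has_sum_infsum[OF mmult_summable[OF assms]])

text \<open>The two bounds compose once the inner index is restricted to a finite set
  \<open>Z\<close>; the restriction is removed by letting \<open>Z\<close> grow, since for fixed
  \<open>S\<close> and \<open>T\<close> finitely many limits are involved.\<close>

lemma opbd_mmult:
  assumes "opbd a C" "opbd b D"
  shows "opbd (mmult a b) (C * D)"
  unfolding opbd_def
proof (intro conjI allI impI)
  fix S T :: "'a set" and w :: "'a \<Rightarrow> complex"
  assume fin: "finite S" "finite T"
  define u where "u z = (\<Sum>y\<in>T. b z y * w y)" for z
  have "((\<lambda>z. a x z * u z) has_sum (\<Sum>y\<in>T. mmult a b x y * w y)) UNIV" for x
  proof -
    have "((\<lambda>z. \<Sum>y\<in>T. a x z * b z y * w y) has_sum (\<Sum>y\<in>T. mmult a b x y * w y)) UNIV"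
      using fin(2)
    proof induction
      case (insert y T)
      show ?case
        unfolding sum.insert[OF insert.hyps]
        by (intro has_sum_add insert.IH has_sum_cmult_left mmult_has_sum[OF assms])
    qed simp
    then show ?thesis by (simp add: u_def sum_distrib_left mult.assoc)
  qed
  then have "((\<lambda>Z. L2_set (\<lambda>x. cmod (\<Sum>z\<in>Z. a x z * u z)) S) \<longlongrightarrow>
      L2_set (\<lambda>x. cmod (\<Sum>y\<in>T. mmult a b x y * w y)) S) (finite_subsets_at_top UNIV)"
    unfolding has_sum_def L2_set_def by (intro tendsto_intros)
  moreover have "\<forall>\<^sub>F Z in finite_subsets_at_top UNIV.
      L2_set (\<lambda>x. cmod (\<Sum>z\<in>Z. a x z * u z)) S \<le> C * D * L2_set (\<lambda>y. cmod (w y)) T"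
  proof (rule eventually_finite_subsets_at_top_weakI)
    fix Z :: "'a set" assume "finite Z"
    then have "L2_set (\<lambda>x. cmod (\<Sum>z\<in>Z. a x z * u z)) S \<le> C * L2_set (\<lambda>z. cmod (u z)) Z"
      by (intro opbdD assms fin)
    also have "\<dots> \<le> C * (D * L2_set (\<lambda>y. cmod (w y)) T)"
      unfolding u_def by (intro mult_left_mono opbdD assms fin \<open>finite Z\<close> opbd_nonneg[OF assms(1)])
    finally show "L2_set (\<lambda>x. cmod (\<Sum>z\<in>Z. a x z * u z)) S \<le> C * D * L2_set (\<lambda>y. cmod (w y)) T"
      by (simp add: mult.assoc)
  qed
  ultimately show "L2_set (\<lambda>x. cmod (\<Sum>y\<in>T. mmult a b x y * w y)) S \<le> C * D * L2_set (\<lambda>y. cmod (w y)) T"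
    by (rule tendsto_upperbound) simp
qed (use opbd_nonneg[OF assms(1)] opbd_nonneg[OF assms(2)] in simp)

section \<open>Bounds for limits, diagonal matrices and band matrices\<close>

text \<open>Entrywise convergence is enough because the bound is tested on finite sets. Completeness
  of the algebra rests on this.\<close>

lemma opbd_limit:
  assumes "0 \<le> C" "\<forall>\<^sub>F n in sequentially. opbd (A n) C" "\<And>x y. (\<lambda>n. A n x y) \<longlonglongrightarrow> a x y"
  shows "opbd a C"
  unfolding opbd_def
proof (intro conjI allI impI)
  fix S T :: "'a set" and w :: "'a \<Rightarrow> complex"
  assume fin: "finite S" "finite T"
  have "(\<lambda>n. L2_set (\<lambda>x. cmod (\<Sum>y\<in>T. A n x y * w y)) S) \<longlonglongrightarrow> L2_set (\<lambda>x. cmod (\<Sum>y\<in>T. a x y * w y)) S"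
    unfolding L2_set_def by (intro tendsto_intros assms)
  moreover have "\<forall>\<^sub>F n in sequentially.
      L2_set (\<lambda>x. cmod (\<Sum>y\<in>T. A n x y * w y)) S \<le> C * L2_set (\<lambda>y. cmod (w y)) T"
    using assms(2) by eventually_elim (intro opbdD fin)
  ultimately show "L2_set (\<lambda>x. cmod (\<Sum>y\<in>T. a x y * w y)) S \<le> C * L2_set (\<lambda>y. cmod (w y)) T"
    by (rule tendsto_upperbound) simp
qed (rule assms(1))

lemma opbd_diag:
  assumes "0 \<le> C" "\<And>x. cmod (f x) \<le> C"
  shows "opbd (diag f) C"
  unfolding opbd_def
proof (intro conjI allI impI)
  fix S T :: "'a set" and w :: "'a \<Rightarrow> complex"
  assume fin: "finite S" "finite T"
  have eq: "(\<Sum>y\<in>T. diag f x y * w y) = (if x \<in> T then f x * w x else 0)" for x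
    using fin by (simp add: diag_def if_distrib[of "\<lambda>u. u * _"] cong: if_cong)
  have "L2_set (\<lambda>x. cmod (\<Sum>y\<in>T. diag f x y * w y)) S = L2_set (\<lambda>x. cmod (f x * w x)) (S \<inter> T)"
    unfolding eq L2_set_def sum.inter_restrict[OF fin(1)] by (intro arg_cong[where f = sqrt] sum.cong) auto
  also have "\<dots> \<le> L2_set (\<lambda>x. C * cmod (w x)) (S \<inter> T)"
    using assms by (intro L2_set_mono) (auto simp: norm_mult mult_right_mono)
  also have "\<dots> \<le> L2_set (\<lambda>x. C * cmod (w x)) T"
    unfolding L2_set_def using fin by (intro real_sqrt_le_mono sum_mono2) auto
  finally show "L2_set (\<lambda>x. cmod (\<Sum>y\<in>T. diag f x y * w y)) S \<le> C * L2_set (\<lambda>y. cmod (w y)) T"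
    using assms by (simp add: L2_set_right_distrib)
qed (rule assms(1))

text \<open>Schur test for a band. Cauchy-Schwarz over the pairs in the band splits the form into a
  \<open>v\<close> part and a \<open>w\<close> part; each point occurs in at most \<open>n\<close>
  pairs, in either coordinate by symmetry of \<open>N\<close>, so each part costs a factor
  \<open>sqrt n\<close>.\<close>

lemma opbd_schur:
  assumes "\<And>x y. cmod (a x y) \<le> \<delta>" "0 \<le> \<delta>" "\<And>x. finite (N x)" "\<And>x. card (N x) \<le> n"
    and "\<And>x y. y \<in> N x \<longleftrightarrow> x \<in> N y" "\<And>x y. y \<notin> N x \<Longrightarrow> a x y = 0"
  shows "opbd a (\<delta> * real n)"
proof (rule opbdI_bilinear)
  fix S T :: "'a set" and v w :: "'a \<Rightarrow> complex"
  assume fin: "finite S" "finite T"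
  define P where "P = {(x,y). x \<in> S \<and> y \<in> T \<and> y \<in> N x}"
  have P: "P \<subseteq> S \<times> T" "finite P"
    using fin finite_subset[of P "S \<times> T"] by (auto simp: P_def)
  have bound: "(\<Sum>p\<in>P. (cmod (v (fst p)))\<^sup>2) \<le> real n * (\<Sum>x\<in>S. (cmod (v x))\<^sup>2)"
    if "finite S" "finite T" "P = {(x,y). x \<in> S \<and> y \<in> T \<and> y \<in> N x}" for S T P and v :: "'a \<Rightarrow> complex"
  proof -
    have P': "P = Sigma S (\<lambda>x. T \<inter> N x)" using that by auto
    have "(\<Sum>p\<in>P. (cmod (v (fst p)))\<^sup>2) = (\<Sum>x\<in>S. \<Sum>y\<in>T \<inter> N x. (cmod (v x))\<^sup>2)"
      using sum.Sigma[of S "\<lambda>x. T \<inter> N x" "\<lambda>x y. (cmod (v x))\<^sup>2"] that(1,2)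
      unfolding P' by (simp add: split_def del: sum_constant)
    also have "\<dots> \<le> (\<Sum>x\<in>S. real n * (cmod (v x))\<^sup>2)"
    proof (intro sum_mono)
      fix x
      have "card (T \<inter> N x) \<le> n"
        using card_mono[of "N x" "T \<inter> N x"] assms(3,4)[of x] by auto
      then show "(\<Sum>y\<in>T \<inter> N x. (cmod (v x))\<^sup>2) \<le> real n * (cmod (v x))\<^sup>2"
        by (simp add: mult_right_mono)
    qed
    finally show ?thesis by (simp add: sum_distrib_left)
  qed
  have 1: "L2_set (\<lambda>p. cmod (v (fst p))) P \<le> sqrt (real n) * L2_set (\<lambda>x. cmod (v x)) S"
    using bound[OF fin, of P v] unfolding L2_set_def P_def
    by (simp flip: real_sqrt_mult)
  have swap: "prod.swap ` P = {(y,x). y \<in> T \<and> x \<in> S \<and> x \<in> N y}"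
  proof (intro set_eqI iffI)
    fix p assume "p \<in> {(y,x). y \<in> T \<and> x \<in> S \<and> x \<in> N y}"
    then have "p = prod.swap (prod.swap p)" "prod.swap p \<in> P"
      using assms(5)[of "fst p" "snd p"] by (auto simp: P_def)
    then show "p \<in> prod.swap ` P" by (rule image_eqI)
  next
    fix p assume "p \<in> prod.swap ` P"
    then show "p \<in> {(y,x). y \<in> T \<and> x \<in> S \<and> x \<in> N y}"
      using assms(5)[of "fst p" "snd p"] by (auto simp: P_def)
  qed
  have "L2_set (\<lambda>p. cmod (w (snd p))) P = L2_set (\<lambda>p. cmod (w (fst p))) (prod.swap ` P)"
    unfolding L2_set_def by (subst sum.reindex) auto
  also have "\<dots> \<le> sqrt (real n) * L2_set (\<lambda>x. cmod (w x)) T"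
    using bound[OF fin(2,1) swap, of w] unfolding L2_set_def
    by (simp flip: real_sqrt_mult)
  finally have 2: "L2_set (\<lambda>p. cmod (w (snd p))) P \<le> sqrt (real n) * L2_set (\<lambda>x. cmod (w x)) T" .
  have "(\<Sum>x\<in>S. \<Sum>y\<in>T. cnj (v x) * a x y * w y) = (\<Sum>p\<in>S\<times>T. cnj (v (fst p)) * a (fst p) (snd p) * w (snd p))"
    by (simp add: sum.cartesian_product split_def)
  also have "\<dots> = (\<Sum>p\<in>P. cnj (v (fst p)) * a (fst p) (snd p) * w (snd p))"
  proof (intro sum.mono_neutral_right ballI)
    fix p assume "p \<in> S \<times> T - P"
    then have "a (fst p) (snd p) = 0" by (intro assms(6)) (auto simp: P_def)
    then show "cnj (v (fst p)) * a (fst p) (snd p) * w (snd p) = 0" by simp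
  qed (use fin P(1) in auto)
  also have "cmod \<dots> \<le> (\<Sum>p\<in>P. \<delta> * (\<bar>cmod (v (fst p))\<bar> * \<bar>cmod (w (snd p))\<bar>))"
  proof (intro order_trans[OF norm_sum] sum_mono)
    fix p
    have "cmod (a (fst p) (snd p)) * (cmod (v (fst p)) * cmod (w (snd p))) \<le> \<delta> * (cmod (v (fst p)) * cmod (w (snd p)))"
      using assms(1) by (intro mult_right_mono) auto
    then show "cmod (cnj (v (fst p)) * a (fst p) (snd p) * w (snd p)) \<le> \<delta> * (\<bar>cmod (v (fst p))\<bar> * \<bar>cmod (w (snd p))\<bar>)"
      by (simp add: norm_mult mult_ac)
  qed
  also have "\<dots> \<le> \<delta> * (L2_set (\<lambda>p. cmod (v (fst p))) P * L2_set (\<lambda>p. cmod (w (snd p))) P)"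
    using assms(2) L2_set_mult_ineq[of "\<lambda>p. cmod (v (fst p))" "\<lambda>p. cmod (w (snd p))" P]
    by (simp add: sum_distrib_left[symmetric] mult_left_mono)
  also have "\<dots> \<le> \<delta> * ((sqrt (real n) * L2_set (\<lambda>x. cmod (v x)) S) * (sqrt (real n) * L2_set (\<lambda>x. cmod (w x)) T))"
    using assms(2) by (intro mult_left_mono mult_mono 1 2) auto
  also have "\<dots> = \<delta> * real n * L2_set (\<lambda>x. cmod (v x)) S * L2_set (\<lambda>y. cmod (w y)) T"
    by (simp add: mult_ac)
  finally show "cmod (\<Sum>x\<in>S. \<Sum>y\<in>T. cnj (v x) * a x y * w y)
      \<le> \<delta> * real n * L2_set (\<lambda>x. cmod (v x)) S * L2_set (\<lambda>y. cmod (w y)) T" .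
qed (use assms(2) in simp)

lemma opbd_finite:
  assumes "finite {(x,y). a x y \<noteq> 0}"
  shows "\<exists>C. opbd a C"
proof -
  define P where "P = {(x,y). a x y \<noteq> 0}"
  define F where "F = fst ` P \<union> snd ` P"
  have F: "finite F" using assms by (simp add: F_def P_def)
  have Z: "a x y = 0" if "\<not> (x \<in> F \<and> y \<in> F)" for x y
    using that unfolding F_def P_def by force
  define M where "M = Max (insert 0 ((\<lambda>(x,y). cmod (a x y)) ` P))"
  have M: "0 \<le> M" "\<And>x y. cmod (a x y) \<le> M"
  proof -
    have fin: "finite (insert 0 ((\<lambda>(x,y). cmod (a x y)) ` P))" using assms by (simp add: P_def)
    show M0: "0 \<le> M" unfolding M_def using fin by (intro Max_ge) auto
    fix x y show "cmod (a x y) \<le> M"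
    proof (cases "a x y = 0")
      case False
      then show ?thesis unfolding M_def using fin by (intro Max_ge) (auto simp: P_def)
    qed (use M0 in simp)
  qed
  have "opbd a (M * real (card F))"
  proof (rule opbd_schur[where N = "\<lambda>x. if x \<in> F then F else {}"])
    show "a x y = 0" if "y \<notin> (if x \<in> F then F else {})" for x y
      using that by (intro Z) (auto split: if_splits)
  qed (use F M in auto)
  then show ?thesis by blast
qed

section \<open>Algebra laws for the matrix product\<close>

lemma mmult_madd_left:
  assumes "opbd a A" "opbd b B" "opbd c C"
  shows "mmult (madd a b) c = madd (mmult a c) (mmult b c)"
proof (intro ext)
  fix x y
  show "mmult (madd a b) c x y = madd (mmult a c) (mmult b c) x y"
    using infsum_add[OF mmult_summable[OF assms(1,3), of x y] mmult_summable[OF assms(2,3), of x y]]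
    by (simp add: mmult_def madd_def distrib_right)
qed

lemma mmult_madd_right:
  assumes "opbd a A" "opbd b B" "opbd c C"
  shows "mmult a (madd b c) = madd (mmult a b) (mmult a c)"
proof (intro ext)
  fix x y
  show "mmult a (madd b c) x y = madd (mmult a b) (mmult a c) x y"
    using infsum_add[OF mmult_summable[OF assms(1,2), of x y] mmult_summable[OF assms(1,3), of x y]]
    by (simp add: mmult_def madd_def distrib_left)
qed

lemma mmult_mscale_left: "mmult (mscale c a) b = mscale c (mmult a b)"
  by (intro ext) (simp add: mmult_def mscale_def mult.assoc infsum_cmult_right')

lemma mmult_mscale_right: "mmult a (mscale c b) = mscale c (mmult a b)"
  by (intro ext) (simp add: mmult_def mscale_def mult.left_commute[of _ c] infsum_cmult_right')

lemma infsum_delta: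
  fixes f :: "'a \<Rightarrow> complex"
  assumes "\<And>z. z \<noteq> x \<Longrightarrow> f z = 0"
  shows "infsum f UNIV = f x"
proof -
  have "infsum f UNIV = infsum f {x}" using assms by (intro infsum_cong_neutral) auto
  then show ?thesis by simp
qed

lemma mmult_diag_left: "mmult (diag f) a = (\<lambda>x y. f x * a x y)"
proof (intro ext)
  fix x y show "mmult (diag f) a x y = f x * a x y"
    unfolding mmult_def by (subst infsum_delta[of x]) (auto simp: diag_def)
qed

lemma mmult_diag_right: "mmult a (diag f) = (\<lambda>x y. a x y * f y)"
proof (intro ext)
  fix x y show "mmult a (diag f) x y = a x y * f y"
    unfolding mmult_def by (subst infsum_delta[of y]) (auto simp: diag_def)
qed

lemma mone_eq_diag: "mone = diag (\<lambda>_. 1)"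
  by (simp add: mone_def diag_def)

lemma opbd_mone: "opbd mone 1"
  unfolding mone_eq_diag by (rule opbd_diag) auto

text \<open>With a finitely supported column of \<open>c\<close>, one of the two sums is finite and
  can be exchanged with the infinite one.\<close>

lemma mmult_assoc_finite:
  assumes "opbd a A" "opbd b B" "finite W" "\<And>w. w \<notin> W \<Longrightarrow> c w y = 0"
  shows "mmult (mmult a b) c x y = mmult a (mmult b c) x y"
proof -
  have fin: "mmult d c w y = (\<Sum>z\<in>W. d w z * c z y)" for d w
  proof -
    have "mmult d c w y = infsum (\<lambda>z. d w z * c z y) W"
      unfolding mmult_def using assms(4) by (intro infsum_cong_neutral) auto
    then show ?thesis using assms(3) by simp
  qed
  have "((\<lambda>w. \<Sum>z\<in>W. a x w * b w z * c z y) has_sum (\<Sum>z\<in>W. mmult a b x z * c z y)) UNIV"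
    using assms(3)
  proof induction
    case (insert z W)
    show ?case
      unfolding sum.insert[OF insert.hyps]
      by (intro has_sum_add insert.IH has_sum_cmult_left mmult_has_sum[OF assms(1,2)])
  qed simp
  then have "((\<lambda>w. a x w * mmult b c w y) has_sum (\<Sum>z\<in>W. mmult a b x z * c z y)) UNIV"
    by (simp add: fin sum_distrib_left mult.assoc)
  from infsumI[OF this] show ?thesis
    unfolding fin[of "mmult a b"] mmult_def[of a "mmult b c"] by simp
qed

text \<open>\<open>W\<close> nearly attains the supremum of the finite square sums of the column;
  whatever lies outside \<open>W\<close> can then add at most
  \<open>\<epsilon>\<^sup>2\<close>.\<close>

lemma column_tail:
  assumes "opbd c C" "0 < \<epsilon>"
  obtains W where "finite W" "\<And>S. finite S \<Longrightarrow> L2_set (\<lambda>x. cmod (c x y)) (S - W) \<le> \<epsilon>"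
proof -
  define g where "g S = (\<Sum>x\<in>S. (cmod (c x y))\<^sup>2)" for S
  have L: "L2_set (\<lambda>x. cmod (c x y)) S = sqrt (g S)" for S by (simp add: L2_set_def g_def)
  have bdd: "bdd_above (g ` {S. finite S})"
  proof (rule bdd_aboveI2)
    fix S :: "'a set" assume "S \<in> {S. finite S}"
    then have "sqrt (g S) \<le> C" using opbd_column[OF assms(1), of S y] by (simp add: L)
    then show "g S \<le> C\<^sup>2" by (rule sqrt_le_D)
  qed
  have "\<exists>u\<in>g ` {S. finite S}. Sup (g ` {S. finite S}) - \<epsilon>\<^sup>2 < u"
    using assms(2) by (intro less_cSupD) auto
  then obtain W where W: "finite W" "Sup (g ` {S. finite S}) - \<epsilon>\<^sup>2 < g W" by auto
  show thesis
  proof (rule that[OF W(1)])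
    fix S :: "'a set" assume S: "finite S"
    have "g (S \<union> W) \<le> Sup (g ` {S. finite S})"
      using S W(1) by (intro cSUP_upper bdd) auto
    moreover have "g (S \<union> W) = g (S - W) + g W"
      unfolding g_def using S W(1)
      by (subst sum.union_disjoint[symmetric]) auto
    ultimately have "g (S - W) \<le> \<epsilon>\<^sup>2" using W(2) by simp
    then show "L2_set (\<lambda>x. cmod (c x y)) (S - W) \<le> \<epsilon>"
      using assms(2) by (simp add: L real_le_lsqrt g_def sum_nonneg)
  qed
qed

text \<open>The double sum defining a product of three bounded matrices need not converge
  absolutely, so Fubini does not apply; instead the tail of a single column of the right factor
  is small in operator norm.\<close>
lemma mmult_assoc:
  assumes "opbd a A" "opbd b B" "opbd c C"
  shows "mmult (mmult a b) c = mmult a (mmult b c)"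
proof (intro ext)
  fix x y
  have "cmod (mmult (mmult a b) c x y - mmult a (mmult b c) x y) \<le> 2 * A * B * \<epsilon>" if eps: "\<epsilon> > 0" for \<epsilon>
  proof -
    obtain W where W: "finite W" "\<And>S. finite S \<Longrightarrow> L2_set (\<lambda>x. cmod (c x y)) (S - W) \<le> \<epsilon>"
      using column_tail[OF assms(3) eps, of y] by blast
    \<comment> \<open>An entry in column \<open>y\<close> of either product sees only column
      \<open>y\<close> of \<open>c\<close>, so all other columns are dropped: \<open>c1\<close> is
      finite, and \<open>c2\<close> is a single column of norm at most \<epsilon>.\<close>
    define c1 where "c1 w v = (if w \<in> W \<and> v = y then c w v else 0)" for w v
    define c2 where "c2 w v = (if w \<notin> W \<and> v = y then c w v else 0)" for w v
    have c2: "opbd c2 \<epsilon>"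
      unfolding opbd_def
    proof (intro conjI allI impI)
      fix S T :: "'a set" and w :: "'a \<Rightarrow> complex"
      assume fin: "finite S" "finite T"
      have eq: "(\<Sum>v\<in>T. c2 x v * w v) = (if y \<in> T \<and> x \<notin> W then c x y * w y else 0)" for x
      proof -
        have "(\<Sum>v\<in>T. c2 x v * w v) = (\<Sum>v\<in>T. if v = y then (if x \<notin> W then c x y * w y else 0) else 0)"
          by (intro sum.cong) (auto simp: c2_def)
        then show ?thesis using fin by simp
      qed
      show "L2_set (\<lambda>x. cmod (\<Sum>v\<in>T. c2 x v * w v)) S \<le> \<epsilon> * L2_set (\<lambda>y. cmod (w y)) T"
      proof (cases "y \<in> T")
        case True
        have "L2_set (\<lambda>x. cmod (\<Sum>v\<in>T. c2 x v * w v)) S = L2_set (\<lambda>x. cmod (c x y * w y)) (S - W)"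
          unfolding eq L2_set_def using fin True
          by (intro arg_cong[where f = sqrt] sum.mono_neutral_cong_right) auto
        also have "\<dots> = L2_set (\<lambda>x. cmod (c x y)) (S - W) * cmod (w y)"
          by (subst L2_set_left_distrib) (auto simp: norm_mult)
        also have "\<dots> \<le> \<epsilon> * L2_set (\<lambda>y. cmod (w y)) T"
          using eps True fin by (intro mult_mono W(2) member_le_L2_set) auto
        finally show ?thesis .
      qed (use eps in \<open>simp add: eq L2_set_def sum_nonneg\<close>)
    qed (use eps in simp)
    have c1: "\<exists>D. opbd c1 D"
    proof (rule opbd_finite, rule finite_subset)
      show "{(x, y). c1 x y \<noteq> 0} \<subseteq> W \<times> {y}" by (auto simp: c1_def split: if_splits)
    qed (use W(1) in simp)
    then obtain D where c1: "opbd c1 D" by blast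
    note ab = opbd_mmult[OF assms(1,2)]
    have col: "mmult d c w y = mmult d c1 w y + mmult d c2 w y" if "opbd d E" for d w E
    proof -
      have "mmult d c w y = mmult d (madd c1 c2) w y"
        unfolding mmult_def by (intro infsum_cong) (auto simp: madd_def c1_def c2_def)
      then show ?thesis using mmult_madd_right[OF that c1 c2] by (simp add: madd_def)
    qed
    have "mmult a (mmult b c) x y = mmult a (madd (mmult b c1) (mmult b c2)) x y"
      unfolding mmult_def[of a] madd_def by (simp add: col[OF assms(2)])
    also have "\<dots> = mmult a (mmult b c1) x y + mmult a (mmult b c2) x y"
      using mmult_madd_right[OF assms(1) opbd_mmult[OF assms(2) c1] opbd_mmult[OF assms(2) c2]]
      by (simp add: madd_def)
    finally have r: "mmult a (mmult b c) x y = mmult a (mmult b c1) x y + mmult a (mmult b c2) x y" .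
    have "mmult (mmult a b) c1 x y = mmult a (mmult b c1) x y"
      by (rule mmult_assoc_finite[OF assms(1,2) W(1)]) (simp add: c1_def)
    then have "mmult (mmult a b) c x y - mmult a (mmult b c) x y
        = mmult (mmult a b) c2 x y - mmult a (mmult b c2) x y"
      by (simp add: r col[OF ab])
    also have "cmod \<dots> \<le> A * B * \<epsilon> + A * (B * \<epsilon>)"
      by (intro order_trans[OF norm_triangle_ineq4] add_mono)
        (rule opbd_entry, intro opbd_mmult assms c2)+
    finally show ?thesis by (simp add: mult_ac)
  qed
  note bound = this
  have "cmod (mmult (mmult a b) c x y - mmult a (mmult b c) x y) \<le> 0"
  proof (rule tendsto_lowerbound)
    show "((\<lambda>\<epsilon>. 2 * A * B * \<epsilon>) \<longlongrightarrow> 0) (at_right 0)"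
      by (auto intro!: tendsto_eq_intros)
    show "\<forall>\<^sub>F \<epsilon> in at_right 0. cmod (mmult (mmult a b) c x y - mmult a (mmult b c) x y) \<le> 2 * A * B * \<epsilon>"
      using bound by (auto simp: eventually_at_filter)
  qed simp
  then show "mmult (mmult a b) c x y = mmult a (mmult b c) x y" by simp
qed

lemma madj_mmult: "madj (mmult a b) = mmult (madj b) (madj a)"
proof (intro ext)
  fix x y
  have "madj (mmult a b) x y = infsum (\<lambda>z. cnj (a y z * b z x)) UNIV"
    by (simp add: madj_def mmult_def infsum_cnj del: complex_cnj_mult)
  then show "madj (mmult a b) x y = mmult (madj b) (madj a) x y"
    by (simp add: madj_def mmult_def mult.commute)
qed

lemma msub_eq: "msub a b = madd a (mscale (-1) b)"
  by (simp add: msub_def madd_def mscale_def)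

lemma bounded_op_add: "bounded_op a \<Longrightarrow> bounded_op b \<Longrightarrow> bounded_op (madd a b)"
  unfolding bounded_op_iff using opbd_add by blast

lemma bounded_op_mscale: "bounded_op a \<Longrightarrow> bounded_op (mscale c a)"
  unfolding bounded_op_iff using opbd_mscale by blast

lemma bounded_op_msub: "bounded_op a \<Longrightarrow> bounded_op b \<Longrightarrow> bounded_op (msub a b)"
  unfolding msub_eq by (intro bounded_op_add bounded_op_mscale)

lemma bounded_op_mmult: "bounded_op a \<Longrightarrow> bounded_op b \<Longrightarrow> bounded_op (mmult a b)"
  unfolding bounded_op_iff using opbd_mmult by blast

lemma bounded_op_madj: "bounded_op a \<Longrightarrow> bounded_op (madj a)"
  unfolding bounded_op_iff using opbd_madj by blast

lemma bounded_op_mone: "bounded_op mone"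
  unfolding bounded_op_iff using opbd_mone by blast

lemma opbd_zero: "opbd (\<lambda>x y. 0) 0"
  by (simp add: opbd_def L2_set_def)

lemma opnorm_nonneg: "bounded_op a \<Longrightarrow> 0 \<le> opnorm a"
  using opbd_nonneg opbd_opnorm by blast

lemma opnorm_zero_iff: "bounded_op a \<Longrightarrow> opnorm a = 0 \<longleftrightarrow> a = (\<lambda>x y. 0)"
proof
  assume "bounded_op a" "opnorm a = 0"
  then show "a = (\<lambda>x y. 0)" using opbd_entry[OF opbd_opnorm, of a] by (intro ext) simp
next
  assume "bounded_op a" "a = (\<lambda>x y. 0)"
  then show "opnorm a = 0"
    using opnorm_le[OF opbd_zero, where 'a = 'a] opnorm_nonneg[of a] by simp
qed

lemma opnorm_mscale:
  assumes "bounded_op a"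
  shows "opnorm (mscale c a) = cmod c * opnorm a"
proof (rule antisym)
  show "opnorm (mscale c a) \<le> cmod c * opnorm a"
    by (intro opnorm_le opbd_mscale opbd_opnorm assms)
  show "cmod c * opnorm a \<le> opnorm (mscale c a)"
  proof (cases "c = 0")
    case False
    have "opnorm (mscale (inverse c) (mscale c a)) \<le> cmod (inverse c) * opnorm (mscale c a)"
      by (intro opnorm_le opbd_mscale opbd_opnorm bounded_op_mscale assms)
    moreover have "mscale (inverse c) (mscale c a) = a" using False by (simp add: mscale_def flip: mult.assoc)
    ultimately show ?thesis using False by (simp add: norm_inverse norm_divide field_simps)
  qed (use opnorm_nonneg[OF bounded_op_mscale[OF assms]] in simp)
qed

lemma opnorm_madj:
  assumes "bounded_op a"
  shows "opnorm (madj a) = opnorm a"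
proof (rule antisym)
  show "opnorm (madj a) \<le> opnorm a" by (intro opnorm_le opbd_madj opbd_opnorm assms)
  have "opnorm (madj (madj a)) \<le> opnorm (madj a)"
    by (intro opnorm_le opbd_madj[OF opbd_opnorm] bounded_op_madj assms)
  then show "opnorm a \<le> opnorm (madj a)" by (simp add: madj_def)
qed

lemma opnorm_mone: "opnorm (mone :: 'a mat) = 1"
proof (rule antisym)
  show "opnorm (mone :: 'a mat) \<le> 1" by (rule opnorm_le[OF opbd_mone])
  show "1 \<le> opnorm (mone :: 'a mat)"
    using opbd_entry[OF opbd_opnorm[OF bounded_op_mone], of "undefined :: 'a" undefined]
    by (simp add: mone_def)
qed

section \<open>The Banach algebra of bounded operators\<close>

text \<open>A type of its own lets bounded matrices become an instance of the classes of normed and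
  complete algebras, so that limits, closures and power series are available.\<close>

typedef 'a bop = "{a :: 'a mat. bounded_op a}" morphisms mat_of Bop
  using bounded_op_mone by blast

setup_lifting type_definition_bop

text \<open>The algebra classes carry real scalars; complex ones are kept as a separate
  operation.\<close>

lift_definition cscale :: "complex \<Rightarrow> 'a bop \<Rightarrow> 'a bop" is mscale
  by (rule bounded_op_mscale)

lift_definition adj :: "'a bop \<Rightarrow> 'a bop" is madj
  by (rule bounded_op_madj)

instantiation bop :: (type) real_normed_algebra_1
begin

lift_definition zero_bop :: "'a bop" is "\<lambda>x y. 0"
  unfolding bounded_op_iff using opbd_zero by blast
lift_definition one_bop :: "'a bop" is mone by (rule bounded_op_mone)
lift_definition plus_bop :: "'a bop \<Rightarrow> 'a bop \<Rightarrow> 'a bop" is madd by (rule bounded_op_add)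
lift_definition minus_bop :: "'a bop \<Rightarrow> 'a bop \<Rightarrow> 'a bop" is msub by (rule bounded_op_msub)
lift_definition uminus_bop :: "'a bop \<Rightarrow> 'a bop" is "mscale (-1)" by (rule bounded_op_mscale)
lift_definition times_bop :: "'a bop \<Rightarrow> 'a bop \<Rightarrow> 'a bop" is mmult by (rule bounded_op_mmult)
lift_definition scaleR_bop :: "real \<Rightarrow> 'a bop \<Rightarrow> 'a bop" is "\<lambda>r. mscale (of_real r)"
  by (rule bounded_op_mscale)
lift_definition norm_bop :: "'a bop \<Rightarrow> real" is opnorm .

definition dist_bop :: "'a bop \<Rightarrow> 'a bop \<Rightarrow> real" where "dist_bop a b = norm (a - b)"
definition "(uniformity :: ('a bop \<times> 'a bop) filter) = (INF e\<in>{0 <..}. principal {(x, y). dist x y < e})"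
definition open_bop :: "'a bop set \<Rightarrow> bool"
  where "open_bop S = (\<forall>x\<in>S. \<forall>\<^sub>F (x', y) in uniformity. x' = x \<longrightarrow> y \<in> S)"
definition sgn_bop :: "'a bop \<Rightarrow> 'a bop" where "sgn_bop x = scaleR (inverse (norm x)) x"

instance
proof
  fix a b c :: "'a bop" and r s :: real
  show "a + b + c = a + (b + c)" "a + b = b + a" "0 + a = a" "- a + a = 0" "a - b = a + - b"
    by (transfer, simp add: madd_def mscale_def msub_def add_ac)+
  show "r *\<^sub>R (a + b) = r *\<^sub>R a + r *\<^sub>R b" "(r + s) *\<^sub>R a = r *\<^sub>R a + s *\<^sub>R a"
    "r *\<^sub>R s *\<^sub>R a = (r * s) *\<^sub>R a" "1 *\<^sub>R a = a"
    by (transfer, simp add: madd_def mscale_def algebra_simps)+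
  show "a * b * c = a * (b * c)"
    by transfer (rule mmult_assoc[OF opbd_opnorm opbd_opnorm opbd_opnorm])
  show "1 * a = a" "a * 1 = a"
    by (transfer, simp add: mone_eq_diag mmult_diag_left mmult_diag_right)+
  show "(a + b) * c = a * c + b * c"
    by transfer (rule mmult_madd_left[OF opbd_opnorm opbd_opnorm opbd_opnorm])
  show "a * (b + c) = a * b + a * c"
    by transfer (rule mmult_madd_right[OF opbd_opnorm opbd_opnorm opbd_opnorm])
  show "(0 :: 'a bop) \<noteq> 1"
    by transfer (auto simp: mone_def fun_eq_iff)
  show "r *\<^sub>R a * b = r *\<^sub>R (a * b)" "a * r *\<^sub>R b = r *\<^sub>R (a * b)"
    by (transfer, simp add: mmult_mscale_left mmult_mscale_right)+
  show "dist a b = norm (a - b)" "sgn a = inverse (norm a) *\<^sub>R a"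
    by (simp_all add: dist_bop_def sgn_bop_def)
  show "(uniformity :: ('a bop \<times> 'a bop) filter) = (INF e\<in>{0 <..}. principal {(x, y). dist x y < e})"
    by (simp add: uniformity_bop_def)
  show "open U = (\<forall>x\<in>U. \<forall>\<^sub>F (x', y) in uniformity. x' = x \<longrightarrow> y \<in> U)" for U :: "'a bop set"
    by (simp add: open_bop_def)
  show "(norm a = 0) = (a = 0)" by transfer (rule opnorm_zero_iff)
  show "norm (a + b) \<le> norm a + norm b"
    by transfer (intro opnorm_le opbd_add opbd_opnorm)
  show "norm (r *\<^sub>R a) = \<bar>r\<bar> * norm a" by transfer (simp add: opnorm_mscale)
  show "norm (a * b) \<le> norm a * norm b"
    by transfer (intro opnorm_le opbd_mmult opbd_opnorm)
  show "norm (1 :: 'a bop) = 1" by transfer (rule opnorm_mone)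
qed

end

lemma opbd_norm: "opbd (mat_of a) (norm a)"
  by transfer (rule opbd_opnorm)

lemma norm_bop_le: "opbd (mat_of a) C \<Longrightarrow> norm a \<le> C"
  by transfer (rule opnorm_le)

lemma entry_le_norm: "cmod (mat_of a x y) \<le> norm a"
  by (rule opbd_entry[OF opbd_norm])

text \<open>Cauchy sequences converge entrywise, and the convergence is in norm because the Cauchy
  estimate for \<open>X m - X n\<close> survives the limit in \<open>m\<close> by
  \<open>opbd_limit\<close>. The limit matrix is bounded since it is at finite distance from one
  \<open>X N\<close>.\<close>

instance bop :: (type) banach
proof
  fix X :: "nat \<Rightarrow> 'a bop"
  assume X: "Cauchy X"
  define A where "A x y = lim (\<lambda>n. mat_of (X n) x y)" for x y
  have A: "(\<lambda>n. mat_of (X n) x y) \<longlonglongrightarrow> A x y" for x y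
  proof -
    have "Cauchy (\<lambda>n. mat_of (X n) x y)"
    proof (rule metric_CauchyI)
      fix e :: real assume "e > 0"
      with X obtain M where M: "\<And>m n. m \<ge> M \<Longrightarrow> n \<ge> M \<Longrightarrow> dist (X m) (X n) < e"
        unfolding Cauchy_def by blast
      have "dist (mat_of (X m) x y) (mat_of (X n) x y) \<le> dist (X m) (X n)" for m n
        using entry_le_norm[of "X m - X n" x y] by (simp add: dist_norm minus_bop.rep_eq msub_def)
      then show "\<exists>M. \<forall>m\<ge>M. \<forall>n\<ge>M. dist (mat_of (X m) x y) (mat_of (X n) x y) < e"
        using M le_less_trans by blast
    qed
    then show ?thesis unfolding A_def by (simp add: Cauchy_convergent_iff convergent_LIMSEQ_iff)
  qed
  have lim: "\<exists>N. \<forall>n\<ge>N. opbd (msub A (mat_of (X n))) e" if e: "e > 0" for e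
  proof -
    from X e obtain N where N: "\<And>m n. m \<ge> N \<Longrightarrow> n \<ge> N \<Longrightarrow> dist (X m) (X n) < e"
      unfolding Cauchy_def by blast
    have "opbd (msub A (mat_of (X n))) e" if n: "n \<ge> N" for n
    proof (rule opbd_limit)
      show "\<forall>\<^sub>F m in sequentially. opbd (mat_of (X m - X n)) e"
        using eventually_ge_at_top[of N]
      proof eventually_elim
        case (elim m)
        then have "norm (X m - X n) \<le> e" using N[OF elim n] by (simp add: dist_norm)
        then show ?case using opbd_norm[of "X m - X n"] unfolding opbd_def
          by (smt (verit) L2_set_nonneg mult_right_mono)
      qed
      show "(\<lambda>m. mat_of (X m - X n) x y) \<longlonglongrightarrow> msub A (mat_of (X n)) x y" for x y
        unfolding minus_bop.rep_eq msub_def by (intro tendsto_intros A)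
    qed (use e in simp)
    then show ?thesis by blast
  qed
  obtain N where "opbd (msub A (mat_of (X N))) 1" using lim[of 1] by auto
  then have "opbd (madd (msub A (mat_of (X N))) (mat_of (X N))) (1 + norm (X N))"
    by (intro opbd_add opbd_norm)
  then have "bounded_op A" unfolding bounded_op_iff by (auto simp: madd_def msub_def)
  then have rep: "mat_of (Bop A) = A" by (simp add: Bop_inverse)
  have "X \<longlonglongrightarrow> Bop A"
  proof (rule metric_LIMSEQ_I)
    fix e :: real assume "e > 0"
    then obtain N where "\<forall>n\<ge>N. opbd (msub A (mat_of (X n))) (e/2)" using lim[of "e/2"] by auto
    then have "\<forall>n\<ge>N. norm (Bop A - X n) \<le> e/2"
      by (intro allI impI norm_bop_le) (simp only: minus_bop.rep_eq rep)
    then show "\<exists>N. \<forall>n\<ge>N. dist (X n) (Bop A) < e"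
      using \<open>e > 0\<close> by (metis dist_commute dist_norm field_sum_of_halves less_add_same_cancel2 half_gt_zero le_less_trans)
  qed
  then show "convergent X" unfolding convergent_def by blast
qed

section \<open>Adjoints and complex scalars\<close>

lemma adj_adj [simp]: "adj (adj a) = a"
  by transfer (simp add: madj_def)

lemma adj_mult: "adj (a * b) = adj b * adj a"
  by transfer (rule madj_mmult)

lemma adj_add: "adj (a + b) = adj a + adj b"
  by transfer (simp add: madj_def madd_def)

lemma adj_scaleR: "adj (r *\<^sub>R a) = r *\<^sub>R adj a"
  by transfer (simp add: madj_def mscale_def)

lemma adj_cscale: "adj (cscale c a) = cscale (cnj c) (adj a)"
  by transfer (simp add: madj_def mscale_def)

lemma adj_one [simp]: "adj 1 = 1"
  by transfer (simp add: madj_def mone_def fun_eq_iff)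

lemma norm_adj [simp]: "norm (adj a) = norm a"
  by transfer (rule opnorm_madj)

lemma bounded_linear_adj: "bounded_linear adj"
  by (rule bounded_linear_intro[where K = 1]) (auto simp: adj_add adj_scaleR)

lemma adj_power: "adj (a ^ n) = adj a ^ n"
  by (induction n) (auto simp: adj_mult power_commutes)

lemma scaleR_eq_cscale: "r *\<^sub>R a = cscale (of_real r) a"
  by transfer simp

lemma cscale_add: "cscale c (a + b) = cscale c a + cscale c b"
  by transfer (simp add: mscale_def madd_def algebra_simps)

lemma cscale_mult_left: "cscale c a * b = cscale c (a * b)"
  by transfer (rule mmult_mscale_left)

lemma cscale_mult_right: "a * cscale c b = cscale c (a * b)"
  by transfer (rule mmult_mscale_right)

lemma norm_cscale: "norm (cscale c a) = cmod c * norm a"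
  by transfer (rule opnorm_mscale)

lemma cscale_cscale: "cscale c (cscale d a) = cscale (c * d) a"
  by transfer (simp add: mscale_def mult.assoc)

section \<open>Square roots by the binomial series\<close>

text \<open>Successive coefficients have ratio \<open>(1/2 - n) / (n + 1)\<close>, of absolute value
  at most 1. This crude bound suffices for convergence when \<open>norm x < 1\<close>.\<close>

lemma abs_gchoose_half_le_1: "\<bar>(1/2 :: real) gchoose n\<bar> \<le> 1"
proof (induction n)
  case (Suc n)
  have "((1/2 :: real) gchoose Suc n) = ((1/2) gchoose n) * ((1/2 - real n) / real (Suc n))"
    using gbinomial_mult_1[of "1/2 :: real" n] by (simp add: field_simps)
  then have "\<bar>(1/2 :: real) gchoose Suc n\<bar> = \<bar>(1/2 :: real) gchoose n\<bar> * (\<bar>1/2 - real n\<bar> / real (Suc n))"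
    by (simp add: abs_mult)
  also have "\<dots> \<le> 1 * 1"
    using Suc by (intro mult_mono) (auto simp: field_simps)
  finally show ?case by simp
qed simp

text \<open>The binomial series of the square root of 1 - x.\<close>
lemma sqrt_one_minus:
  fixes x :: "'a :: {real_normed_algebra_1, banach}"
  assumes "norm x < 1"
  defines "c \<equiv> \<lambda>n. (-1) ^ n * ((1/2 :: real) gchoose n)"
  shows "summable (\<lambda>n. norm (c n *\<^sub>R x ^ n))"
    and "(\<Sum>n. c n *\<^sub>R x ^ n) * (\<Sum>n. c n *\<^sub>R x ^ n) = 1 - x"
proof -
  show sm: "summable (\<lambda>n. norm (c n *\<^sub>R x ^ n))"
  proof (rule summable_comparison_test)
    have "norm (c n *\<^sub>R x ^ n) \<le> 1 * norm x ^ n" for n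
      unfolding norm_scaleR
      by (intro mult_mono norm_power_ineq) (auto simp: c_def abs_mult abs_gchoose_half_le_1)
    then show "\<exists>N. \<forall>n\<ge>N. norm (norm (c n *\<^sub>R x ^ n)) \<le> norm x ^ n" by auto
    show "summable (\<lambda>n. norm x ^ n)" using assms(1) by (simp add: summable_geometric)
  qed
  \<comment> \<open>Vandermonde: convolving the coefficients of exponent 1/2 with themselves gives
    those of exponent 1, which vanish from k = 2 on.\<close>
  have coeff: "(\<Sum>i\<le>k. (c i *\<^sub>R x ^ i) * (c (k - i) *\<^sub>R x ^ (k - i))) = ((-1) ^ k * (1 gchoose k)) *\<^sub>R x ^ k" for k
  proof -
    have cc: "c i * c (k - i) = (-1) ^ k * (((1/2) gchoose i) * ((1/2) gchoose (k - i)))" if "i \<le> k" for i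
    proof -
      have "(-1 :: real) ^ i * (-1) ^ (k - i) = (-1) ^ k" using that by (simp flip: power_add)
      then show ?thesis unfolding c_def by (metis mult.assoc mult.left_commute)
    qed
    have "(\<Sum>i\<le>k. (c i *\<^sub>R x ^ i) * (c (k - i) *\<^sub>R x ^ (k - i))) = (\<Sum>i\<le>k. (c i * c (k - i)) *\<^sub>R x ^ k)"
      by (intro sum.cong) (auto simp flip: power_add simp: mult.commute)
    also have "\<dots> = (\<Sum>i\<le>k. (-1) ^ k * (((1/2) gchoose i) * ((1/2) gchoose (k - i)))) *\<^sub>R x ^ k"
      unfolding scaleR_left.sum by (intro sum.cong refl) (simp only: cc atMost_iff)
    also have "(\<Sum>i\<le>k. (-1) ^ k * (((1/2 :: real) gchoose i) * ((1/2) gchoose (k - i)))) = (-1) ^ k * (1 gchoose k)"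
      using gbinomial_Vandermonde[of "1/2 :: real" "1/2" k]
      by (simp add: sum_distrib_left[symmetric] atLeast0AtMost)
    finally show ?thesis .
  qed
  have "(\<Sum>n. c n *\<^sub>R x ^ n) * (\<Sum>n. c n *\<^sub>R x ^ n) = (\<Sum>k. ((-1) ^ k * (1 gchoose k)) *\<^sub>R x ^ k)"
    unfolding Cauchy_product[OF sm sm] coeff ..
  also have "\<dots> = (\<Sum>k\<in>{0, 1}. ((-1) ^ k * (1 gchoose k)) *\<^sub>R x ^ k)"
  proof (rule suminf_finite)
    fix k :: nat assume "k \<notin> {0, 1}"
    then have "(1 :: real) gchoose k = 0" using binomial_gbinomial[of 1 k, where 'a = real] by (simp add: binomial_eq_0)
    then show "((-1) ^ k * (1 gchoose k)) *\<^sub>R x ^ k = 0" by simp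
  qed simp
  finally show "(\<Sum>n. c n *\<^sub>R x ^ n) * (\<Sum>n. c n *\<^sub>R x ^ n) = 1 - x" by simp
qed

text \<open>Partial sums are real combinations of powers of \<open>x\<close>, so the root is
  selfadjoint and stays in any closed real subspace containing these powers. \<open>S\<close> will
  be the Roe algebra, where positivity of a state can be applied to \<open>b\<close>.\<close>

lemma selfadjoint_sqrt:
  fixes x :: "'a bop"
  assumes "norm x < 1" "adj x = x" "closed S" "subspace S" "\<And>n. x ^ n \<in> S"
  obtains b where "b \<in> S" "adj b = b" "b * b = 1 - x"
proof -
  define c where "c n = (-1) ^ n * ((1/2 :: real) gchoose n)" for n
  define b where "b = (\<Sum>n. c n *\<^sub>R x ^ n)"
  have sm: "summable (\<lambda>n. norm (c n *\<^sub>R x ^ n))" and sq: "b * b = 1 - x"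
    unfolding b_def c_def by (rule sqrt_one_minus[OF assms(1)])+
  note sm' = summable_norm_cancel[OF sm]
  have "adj b = (\<Sum>n. adj (c n *\<^sub>R x ^ n))"
    unfolding b_def by (rule bounded_linear.suminf[OF bounded_linear_adj sm'])
  then have "adj b = b" by (simp add: adj_scaleR adj_power assms(2) b_def)
  moreover have "b \<in> S"
  proof (rule Lim_in_closed_set[OF assms(3)])
    show "(\<lambda>n. \<Sum>i<n. c i *\<^sub>R x ^ i) \<longlonglongrightarrow> b"
      unfolding b_def by (rule summable_LIMSEQ[OF sm'])
    show "\<forall>\<^sub>F n in sequentially. (\<Sum>i<n. c i *\<^sub>R x ^ i) \<in> S"
      by (intro always_eventually allI subspace_sum subspace_scale assms)
  qed simp
  ultimately show thesis using that sq by blast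
qed

section \<open>The uniform Roe algebra and the compacts\<close>

lemma closure_mult:
  fixes A B C :: "'a :: real_normed_algebra set"
  assumes "\<And>x y. x \<in> A \<Longrightarrow> y \<in> B \<Longrightarrow> x * y \<in> C" "a \<in> closure A" "b \<in> closure B"
  shows "a * b \<in> closure C"
proof -
  from assms(2,3) obtain f g where "\<And>n. f n \<in> A" "f \<longlonglongrightarrow> a" "\<And>n. g n \<in> B" "g \<longlonglongrightarrow> b"
    unfolding closure_sequential by blast
  then show ?thesis
    unfolding closure_sequential using assms(1)
    by (intro exI[of _ "\<lambda>n. f n * g n"]) (auto intro: tendsto_mult)
qed

lemma bounded_linear_cscale: "bounded_linear (cscale c)"
  by (rule bounded_linear_intro[where K = "cmod c"])
    (auto simp: cscale_add scaleR_eq_cscale cscale_cscale norm_cscale mult.commute)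

definition fin_prop :: "'a::metric_space bop set" where
  "fin_prop = {a. finite_prop (mat_of a)}"

definition fin_supp :: "'a bop set" where
  "fin_supp = {a. finite {(x,y). mat_of a x y \<noteq> 0}}"

definition Roe :: "'a::metric_space bop set" where
  "Roe = closure fin_prop"

definition Cpt :: "'a bop set" where
  "Cpt = closure fin_supp"

lemma ex_bop: "(\<exists>b. bounded_op b \<and> P b) \<longleftrightarrow> (\<exists>b. P (mat_of b))"
  using mat_of Bop_inverse by (metis mem_Collect_eq)

lemma roe_iff: "mat_of a \<in> roe \<longleftrightarrow> a \<in> Roe"
proof -
  have "mat_of a \<in> roe \<longleftrightarrow> (\<forall>\<epsilon>>0. \<exists>b. finite_prop (mat_of b) \<and> norm (a - b) < \<epsilon>)"
    unfolding roe_def using mat_of[of a] by (auto simp: ex_bop norm_bop.rep_eq minus_bop.rep_eq)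
  also have "\<dots> \<longleftrightarrow> a \<in> Roe"
    unfolding Roe_def closure_approachable fin_prop_def
    by (auto simp: dist_norm norm_minus_commute Bex_def)
  finally show ?thesis .
qed

lemma roe_eq: "(roe :: 'a::metric_space mat set) = mat_of ` Roe"
proof
  show "mat_of ` Roe \<subseteq> (roe :: 'a mat set)" using roe_iff by blast
  show "(roe :: 'a mat set) \<subseteq> mat_of ` Roe"
  proof
    fix a :: "'a mat" assume a: "a \<in> roe"
    then have "bounded_op a" by (simp add: roe_def)
    then have "a = mat_of (Bop a)" by (simp add: Bop_inverse)
    with a show "a \<in> mat_of ` Roe" using roe_iff[of "Bop a"] by (intro image_eqI[of _ _ "Bop a"]) auto
  qed
qed

lemma compacts_iff: "mat_of a \<in> compacts \<longleftrightarrow> a \<in> Cpt"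
proof -
  \<comment> \<open>Unlike \<open>roe\<close>, \<open>compacts\<close> does not ask the approximant
    to be bounded; finite support supplies this.\<close>
  have bdd: "bounded_op b" if "finite {(x,y). b x y \<noteq> 0}" for b :: "'a mat"
    using opbd_finite[OF that] by (simp add: bounded_op_iff)
  have "mat_of a \<in> compacts \<longleftrightarrow>
      (\<forall>\<epsilon>>0. \<exists>b. bounded_op b \<and> finite {(x,y). b x y \<noteq> 0} \<and> opnorm (msub (mat_of a) b) < \<epsilon>)"
    unfolding compacts_def using mat_of[of a] bdd by blast
  also have "\<dots> \<longleftrightarrow> (\<forall>\<epsilon>>0. \<exists>b. b \<in> fin_supp \<and> norm (a - b) < \<epsilon>)"
    by (simp add: ex_bop norm_bop.rep_eq minus_bop.rep_eq fin_supp_def)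
  also have "\<dots> \<longleftrightarrow> a \<in> Cpt"
    unfolding Cpt_def closure_approachable by (auto simp: dist_norm norm_minus_commute Bex_def)
  finally show ?thesis .
qed

lemma mmult_nonzero:
  assumes "mmult a b x y \<noteq> 0"
  obtains z where "a x z \<noteq> 0" "b z y \<noteq> 0"
proof -
  have "\<exists>z. a x z * b z y \<noteq> 0"
  proof (rule ccontr)
    assume "\<nexists>z. a x z * b z y \<noteq> 0"
    then have "(\<lambda>z. a x z * b z y) = (\<lambda>_. 0)" by (intro ext) blast
    then show False using assms by (simp only: mmult_def infsum_0_simp simp_thms)
  qed
  then show thesis using that by auto
qed

lemma fin_prop_subspace: "subspace fin_prop"
  unfolding subspace_def fin_prop_def finite_prop_def mem_Collect_eq
proof (intro conjI ballI allI)
  show "\<exists>R. \<forall>x y :: 'a. mat_of 0 x y \<noteq> 0 \<longrightarrow> dist x y \<le> R" by (simp add: zero_bop.rep_eq)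
  fix a b :: "'a bop" and c :: real
  assume "a \<in> {a. \<exists>R. \<forall>x y. mat_of a x y \<noteq> 0 \<longrightarrow> dist x y \<le> R}"
  then obtain R where R: "\<And>x y. mat_of a x y \<noteq> 0 \<Longrightarrow> dist x y \<le> R" by auto
  then show "\<exists>R. \<forall>x y. mat_of (c *\<^sub>R a) x y \<noteq> 0 \<longrightarrow> dist x y \<le> R"
    by (auto simp: scaleR_bop.rep_eq mscale_def)
  assume "b \<in> {a. \<exists>R. \<forall>x y. mat_of a x y \<noteq> 0 \<longrightarrow> dist x y \<le> R}"
  then obtain R' where R': "\<And>x y. mat_of b x y \<noteq> 0 \<Longrightarrow> dist x y \<le> R'" by auto
  have "dist x y \<le> max R R'" if "mat_of (a + b) x y \<noteq> 0" for x y
  proof -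
    have "mat_of a x y \<noteq> 0 \<or> mat_of b x y \<noteq> 0"
      using that by (auto simp: plus_bop.rep_eq madd_def)
    then show ?thesis using R[of x y] R'[of x y] by auto
  qed
  then show "\<exists>R. \<forall>x y. mat_of (a + b) x y \<noteq> 0 \<longrightarrow> dist x y \<le> R" by blast
qed

lemma fin_prop_mult:
  assumes "a \<in> fin_prop" "b \<in> fin_prop"
  shows "a * b \<in> fin_prop"
proof -
  from assms obtain R R' where R: "\<And>x y. mat_of a x y \<noteq> 0 \<Longrightarrow> dist x y \<le> R"
    "\<And>x y. mat_of b x y \<noteq> 0 \<Longrightarrow> dist x y \<le> R'"
    unfolding fin_prop_def finite_prop_def by blast
  have "dist x y \<le> R + R'" if "mat_of (a * b) x y \<noteq> 0" for x y
    using that[unfolded times_bop.rep_eq]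
  proof (rule mmult_nonzero)
    fix z assume "mat_of a x z \<noteq> 0" "mat_of b z y \<noteq> 0"
    then show ?thesis using R dist_triangle[of x y z] by (metis add_mono order_trans)
  qed
  then show ?thesis unfolding fin_prop_def finite_prop_def by blast
qed

lemma fin_prop_adj: "a \<in> fin_prop \<Longrightarrow> adj a \<in> fin_prop"
  unfolding fin_prop_def finite_prop_def mem_Collect_eq adj.rep_eq madj_def
  by (metis complex_cnj_zero dist_commute)

lemma fin_prop_cscale: "a \<in> fin_prop \<Longrightarrow> cscale c a \<in> fin_prop"
  unfolding fin_prop_def finite_prop_def by (auto simp: cscale.rep_eq mscale_def)

lemma Roe_subspace: "subspace Roe"
  unfolding subspace_def Roe_def
proof (intro conjI ballI allI)
  note sub = fin_prop_subspace[unfolded subspace_def, rule_format]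
  show "0 \<in> closure fin_prop" using sub closure_subset by blast
  show "a + b \<in> closure fin_prop" if "a \<in> closure fin_prop" "b \<in> closure fin_prop" for a b :: "'a bop"
  proof -
    from that obtain f g where "\<And>n. f n \<in> fin_prop" "f \<longlonglongrightarrow> a" "\<And>n. g n \<in> fin_prop" "g \<longlonglongrightarrow> b"
      unfolding closure_sequential by blast
    then show ?thesis
      unfolding closure_sequential
      by (intro exI[of _ "\<lambda>n. f n + g n"]) (auto intro: tendsto_add subspace_add[OF fin_prop_subspace])
  qed
  show "c *\<^sub>R a \<in> closure fin_prop" if "a \<in> closure fin_prop" for a :: "'a bop" and c
  proof -
    from that obtain f where "\<And>n. f n \<in> fin_prop" "f \<longlonglongrightarrow> a"
      unfolding closure_sequential by blast
    then show ?thesis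
      unfolding closure_sequential
      by (intro exI[of _ "\<lambda>n. c *\<^sub>R f n"]) (auto intro: tendsto_scaleR subspace_scale[OF fin_prop_subspace])
  qed
qed

lemmas Roe_add = subspace_add[OF Roe_subspace]
  and Roe_diff = subspace_diff[OF Roe_subspace]
  and Roe_scaleR = subspace_scale[OF Roe_subspace]

lemma Roe_closed: "closed Roe"
  by (simp add: Roe_def)

lemma Roe_mult: "a \<in> Roe \<Longrightarrow> b \<in> Roe \<Longrightarrow> a * b \<in> Roe"
  unfolding Roe_def using closure_mult fin_prop_mult by blast

lemma Roe_adj: "a \<in> Roe \<Longrightarrow> adj a \<in> Roe"
  unfolding Roe_def
  using image_closure_subset[of fin_prop adj "closure fin_prop"] fin_prop_adj closure_subset
    linear_continuous_on[OF bounded_linear_adj] by blast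

lemma Roe_cscale: "a \<in> Roe \<Longrightarrow> cscale c a \<in> Roe"
  unfolding Roe_def
  using image_closure_subset[of fin_prop "cscale c" "closure fin_prop"] fin_prop_cscale closure_subset
    linear_continuous_on[OF bounded_linear_cscale] by blast

section \<open>Diagonal operators\<close>

text \<open>\<open>Bop\<close> is meaningful only on bounded matrices, hence the condition
  \<open>bounded (range f)\<close> in the rules for \<open>dg\<close>.\<close>

definition dg :: "('a \<Rightarrow> complex) \<Rightarrow> 'a bop" where
  "dg f = Bop (diag f)"

lemma bounded_op_diag: "bounded (range f) \<Longrightarrow> bounded_op (diag f)"
  unfolding bounded_iff bounded_op_iff
  by (meson opbd_diag norm_ge_zero order_trans rangeI)

lemma mat_of_dg: "bounded (range f) \<Longrightarrow> mat_of (dg f) = diag f"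
  unfolding dg_def by (rule Bop_inverse) (simp add: bounded_op_diag)

lemma dg_Roe: "bounded (range f) \<Longrightarrow> dg f \<in> Roe"
  unfolding Roe_def
  by (rule closure_subset[THEN subsetD])
    (auto simp: fin_prop_def finite_prop_def mat_of_dg diag_def intro!: exI[of _ 0])

lemma one_eq_dg: "1 = dg (\<lambda>_. 1)"
  by (simp add: mat_of_inject[symmetric] mat_of_dg one_bop.rep_eq mone_eq_diag)

lemma Roe_one: "1 \<in> Roe"
  unfolding one_eq_dg by (rule dg_Roe) simp

lemma Roe_power: "a \<in> Roe \<Longrightarrow> a ^ n \<in> Roe"
  by (induction n) (auto intro: Roe_one Roe_mult)

lemma bounded_range_iff: "bounded (range f) \<longleftrightarrow> (\<exists>C. \<forall>x. cmod (f x) \<le> C)"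
  by (auto simp: bounded_iff)

lemma bounded_range_add:
  fixes f g :: "'a \<Rightarrow> complex"
  shows "bounded (range f) \<Longrightarrow> bounded (range g) \<Longrightarrow> bounded (range (\<lambda>x. f x + g x))"
  by (rule bounded_plus_comp)

lemma bounded_range_mult:
  fixes f g :: "'a \<Rightarrow> complex"
  assumes "bounded (range f)" "bounded (range g)"
  shows "bounded (range (\<lambda>x. f x * g x))"
proof -
  from assms obtain C D where "\<And>x. cmod (f x) \<le> C" "\<And>x. cmod (g x) \<le> D"
    unfolding bounded_range_iff by blast
  then have "cmod (f x * g x) \<le> C * D" for x
    unfolding norm_mult by (intro mult_mono) (auto intro: order_trans[OF norm_ge_zero])
  then show ?thesis unfolding bounded_range_iff by blast
qed

lemma dg_add: "bounded (range f) \<Longrightarrow> bounded (range g) \<Longrightarrow> dg (\<lambda>x. f x + g x) = dg f + dg g"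
  by (simp add: mat_of_inject[symmetric] plus_bop.rep_eq mat_of_dg bounded_range_add)
    (simp add: madd_def diag_def fun_eq_iff)

lemma dg_mult: "bounded (range f) \<Longrightarrow> bounded (range g) \<Longrightarrow> dg (\<lambda>x. f x * g x) = dg f * dg g"
  by (simp add: mat_of_inject[symmetric] times_bop.rep_eq mat_of_dg bounded_range_mult mmult_diag_left)
    (simp add: diag_def fun_eq_iff)

lemma dg_cscale: "bounded (range f) \<Longrightarrow> dg (\<lambda>x. c * f x) = cscale c (dg f)"
  using bounded_range_mult[of "\<lambda>_. c" f]
  by (simp add: mat_of_inject[symmetric] cscale.rep_eq mat_of_dg)
    (simp add: mscale_def diag_def fun_eq_iff)

lemma adj_dg_real: "bounded (range (\<lambda>x. complex_of_real (u x))) \<Longrightarrow> adj (dg (\<lambda>x. of_real (u x))) = dg (\<lambda>x. of_real (u x))"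
  by (simp add: mat_of_inject[symmetric] adj.rep_eq mat_of_dg)
    (simp add: madj_def diag_def fun_eq_iff)

section \<open>Compacts, finite balls and commutators\<close>

lemma ulf_finite_ball:
  assumes "ulf TYPE('a::metric_space)"
  shows "finite (ball (x :: 'a) r)"
proof (cases "r > 0")
  case True
  then show ?thesis using assms unfolding ulf_def by blast
qed (simp add: ball_empty)

text \<open>Finite balls enter here: a factor of finite propagation moves a finite support only
  within finitely many balls, so it stays finite, and closures do the rest. Absorption on this one
  side is what reweighting a KMS state asks for.\<close>

lemma Cpt_mult_right:
  fixes k :: "'a::metric_space bop"
  assumes "ulf TYPE('a)" "k \<in> Cpt" "a \<in> Roe"
  shows "k * a \<in> Cpt"
  unfolding Cpt_def
proof (rule closure_mult[OF _ assms(2)[unfolded Cpt_def] assms(3)[unfolded Roe_def]])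
  fix b c :: "'a bop"
  assume b: "b \<in> fin_supp" and c: "c \<in> fin_prop"
  from c obtain R where R: "\<And>x y. mat_of c x y \<noteq> 0 \<Longrightarrow> dist x y \<le> R"
    unfolding fin_prop_def finite_prop_def by blast
  let ?P = "{(x,y). mat_of b x y \<noteq> 0}"
  have "{(x,y). mat_of (b * c) x y \<noteq> 0} \<subseteq> (\<Union>p\<in>?P. {fst p} \<times> ball (snd p) (R + 1))"
  proof (rule subsetI)
    fix q assume "q \<in> {(x,y). mat_of (b * c) x y \<noteq> 0}"
    then obtain x y where q: "q = (x, y)" and nz: "mat_of (b * c) x y \<noteq> 0" by blast
    from nz[unfolded times_bop.rep_eq] obtain z where z: "mat_of b x z \<noteq> 0" "mat_of c z y \<noteq> 0"
      by (rule mmult_nonzero)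
    then have "(x, z) \<in> ?P" "y \<in> ball z (R + 1)" using R[of z y] by simp_all
    then show "q \<in> (\<Union>p\<in>?P. {fst p} \<times> ball (snd p) (R + 1))"
      unfolding q by (intro UN_I[of "(x, z)"]) simp_all
  qed
  moreover have "finite (\<Union>p\<in>?P. {fst p} \<times> ball (snd p) (R + 1))"
    by (intro finite_UN_I finite_cartesian_product ulf_finite_ball[OF assms(1)]
        b[unfolded fin_supp_def mem_Collect_eq] finite.intros)
  ultimately have "finite {(x,y). mat_of (b * c) x y \<noteq> 0}"
    by (rule finite_subset)
  then show "b * c \<in> fin_supp"
    unfolding fin_supp_def by (rule CollectI)
qed

text \<open>For \<open>b\<close> of finite propagation the commutator has entries
  \<open>(f x - f y) * mat_of b x y\<close>. Rows and columns through the finite exceptional set of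
  \<open>f\<close> form a finitely supported matrix; what is left has small entries in a band of
  bounded width, hence small norm by the Schur test. Continuity of the commutator covers the
  closure.\<close>

lemma commutator_Cpt:
  fixes a :: "'a::metric_space bop"
  assumes ulf: "ulf TYPE('a)" and f: "f \<in> higson" and a: "a \<in> Roe"
  shows "dg f * a - a * dg f \<in> Cpt"
proof -
  have bf: "bounded (range f)" using f by (simp add: higson_def)
  have "dg f * b - b * dg f \<in> Cpt" if "b \<in> fin_prop" for b
  proof -
    from that obtain R0 where R0: "\<And>x y. mat_of b x y \<noteq> 0 \<Longrightarrow> dist x y \<le> R0"
      unfolding fin_prop_def finite_prop_def by blast
    \<comment> \<open>Positive, and larger than the propagation by 1, so that the closed condition
      on distances fits into open balls.\<close>
    define R where "R = max R0 0 + 1"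
    have Rpos: "R > 0" by (simp add: R_def)
    have R: "dist x y < R" if "mat_of b x y \<noteq> 0" for x y
      using R0[OF that] by (simp add: R_def)
    obtain n where n: "\<And>x :: 'a. card (ball x R) \<le> n" using ulf Rpos unfolding ulf_def by blast
    define k where "k = dg f * b - b * dg f"
    have k: "mat_of k x y = (f x - f y) * mat_of b x y" for x y
      unfolding k_def minus_bop.rep_eq times_bop.rep_eq mat_of_dg[OF bf] mmult_diag_left mmult_diag_right msub_def
      by (simp add: algebra_simps)
    have "\<exists>c\<in>fin_supp. dist c k < \<epsilon>" if \<epsilon>: "\<epsilon> > 0" for \<epsilon>
    proof -
      \<comment> \<open>The Schur bound will be \<open>\<delta> * norm b * real n\<close>. Adding 1
        to \<open>norm b\<close> and to \<open>n\<close> keeps the denominator away from 0, and the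
        factor 2 leaves a strict inequality.\<close>
      define \<delta> where "\<delta> = \<epsilon> / (2 * (norm b + 1) * (real n + 1))"
      have \<delta>: "\<delta> > 0" unfolding \<delta>_def
        by (intro divide_pos_pos mult_pos_pos add_nonneg_pos norm_ge_zero \<epsilon>) simp_all
      then obtain F where F: "finite F" "\<And>x y. x \<notin> F \<Longrightarrow> y \<notin> F \<Longrightarrow> dist x y < R \<Longrightarrow> cmod (f x - f y) < \<delta>"
        using f[unfolded higson_def, simplified, THEN conjunct2, rule_format, OF \<delta> Rpos] by auto
      define k1 where "k1 x y = (if x \<in> F \<or> y \<in> F then mat_of k x y else 0)" for x y
      have fin1: "finite {(x,y). k1 x y \<noteq> 0}"
      proof (rule finite_subset)
        show "{(x,y). k1 x y \<noteq> 0} \<subseteq> (\<Union>x\<in>F. {x} \<times> ball x R) \<union> (\<Union>y\<in>F. ball y R \<times> {y})"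
        proof (rule subsetI)
          fix q assume "q \<in> {(x,y). k1 x y \<noteq> 0}"
          then obtain x y where q: "q = (x, y)" and nz: "k1 x y \<noteq> 0" by blast
          then have "x \<in> F \<or> y \<in> F" "mat_of b x y \<noteq> 0"
            by (auto simp: k1_def k split: if_splits)
          with R[of x y] have "x \<in> F \<and> y \<in> ball x R \<or> y \<in> F \<and> x \<in> ball y R"
            by (auto simp: dist_commute)
          then show "q \<in> (\<Union>x\<in>F. {x} \<times> ball x R) \<union> (\<Union>y\<in>F. ball y R \<times> {y})"
            unfolding q by blast
        qed
        show "finite ((\<Union>x\<in>F. {x} \<times> ball x R) \<union> (\<Union>y\<in>F. ball y R \<times> {y}))"
          by (intro finite_UnI finite_UN_I finite_cartesian_product F(1) ulf_finite_ball[OF ulf] finite.intros)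
      qed
      have "mat_of (Bop k1) = k1"
        using opbd_finite[OF fin1] by (intro Bop_inverse) (simp add: bounded_op_iff)
      then have k1: "Bop k1 \<in> fin_supp" "mat_of (k - Bop k1) = msub (mat_of k) k1"
        using fin1 by (auto simp: fin_supp_def minus_bop.rep_eq)
      have "opbd (msub (mat_of k) k1) (\<delta> * norm b * real n)"
      proof (rule opbd_schur[where N = "\<lambda>x. ball x R"])
        fix x y
        show "cmod (msub (mat_of k) k1 x y) \<le> \<delta> * norm b"
        proof (cases "(x \<in> F \<or> y \<in> F) \<or> mat_of b x y = 0")
          case True
          then show ?thesis using \<delta> by (auto simp: msub_def k1_def k)
        next
          case False
          then have "cmod (f x - f y) < \<delta>" using F(2) R by blast
          then show ?thesis using False entry_le_norm[of b x y] \<delta>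
            by (auto simp: msub_def k1_def k norm_mult intro!: mult_mono)
        qed
        show "y \<in> ball x R \<longleftrightarrow> x \<in> ball y R" by (simp add: dist_commute)
        show "msub (mat_of k) k1 x y = 0" if "y \<notin> ball x R"
        proof -
          have "mat_of b x y = 0" using that R[of x y] by auto
          then show ?thesis by (simp add: msub_def k1_def k)
        qed
        show "finite (ball x R)" by (rule ulf_finite_ball[OF ulf])
        show "card (ball x R) \<le> n" by (rule n)
      qed (use \<delta> in simp)
      then have "norm (k - Bop k1) \<le> \<delta> * norm b * real n"
        using k1(2) by (intro norm_bop_le) simp
      also have "\<dots> \<le> \<delta> * (norm b + 1) * (real n + 1)"
        using \<delta> by (intro mult_mono) auto
      also have "\<dots> = \<epsilon> / 2"
        unfolding \<delta>_def using norm_ge_zero[of b] by (simp add: divide_simps add_nonneg_eq_0_iff)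
      also have "\<dots> < \<epsilon>" using \<epsilon> by simp
      finally have "dist (Bop k1) k < \<epsilon>" by (simp add: dist_norm norm_minus_commute)
      then show ?thesis using k1(1) by blast
    qed
    then show ?thesis unfolding Cpt_def closure_approachable k_def by blast
  qed
  then have "(\<lambda>a. dg f * a - a * dg f) ` closure fin_prop \<subseteq> Cpt"
    by (intro image_closure_subset continuous_intros) (auto simp: Cpt_def)
  then show ?thesis using a unfolding Roe_def by blast
qed

section \<open>Higson functions\<close>

lemma higson_bounded: "f \<in> higson \<Longrightarrow> bounded (range f)"
  by (simp add: higson_def)

text \<open>Bounded ranges have compact closure, where \<open>G\<close> is uniformly continuous, and
  this transfers small variation at infinity. The closed set \<open>S\<close> admits functions
  continuous on part of the plane, such as \<open>inverse\<close> away from 0; sums, products,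
  square roots and truncations also come from here.\<close>

lemma higson_comp2:
  fixes G :: "complex \<times> complex \<Rightarrow> complex"
  assumes f: "f \<in> higson" and g: "g \<in> higson"
    and S: "closed S" "continuous_on S G" "\<And>x. (f x, g x) \<in> S"
  shows "(\<lambda>x. G (f x, g x)) \<in> higson"
proof -
  define K where "K = S \<inter> (closure (range f) \<times> closure (range g))"
  have K: "compact K" unfolding K_def
    using higson_bounded[OF f] higson_bounded[OF g] S(1)
    by (intro closed_Int_compact compact_Times) auto
  have inK: "(f x, g x) \<in> K" for x
    using S(3) closure_subset[of "range f"] closure_subset[of "range g"] by (auto simp: K_def)
  have cont: "continuous_on K G"
    using S(2) by (rule continuous_on_subset) (auto simp: K_def)
  have "bounded (G ` K)" by (intro compact_imp_bounded compact_continuous_image cont K)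
  then have "bounded (range (\<lambda>x. G (f x, g x)))"
    by (rule bounded_subset) (use inK in auto)
  moreover have "\<exists>F. finite F \<and> (\<forall>x y. x \<notin> F \<and> y \<notin> F \<and> dist x y < R \<longrightarrow> cmod (G (f x, g x) - G (f y, g y)) < \<epsilon>)"
    if "\<epsilon> > 0" "R > 0" for \<epsilon> R
  proof -
    from compact_uniformly_continuous[OF cont K] \<open>\<epsilon> > 0\<close> obtain d where d: "d > 0"
      "\<And>p q. p \<in> K \<Longrightarrow> q \<in> K \<Longrightarrow> dist q p < d \<Longrightarrow> dist (G q) (G p) < \<epsilon>"
      unfolding uniformly_continuous_on_def by metis
    obtain F1 where F1: "finite F1" "\<And>x y. x \<notin> F1 \<Longrightarrow> y \<notin> F1 \<Longrightarrow> dist x y < R \<Longrightarrow> cmod (f x - f y) < d/2"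
      using f d(1) \<open>R > 0\<close> unfolding higson_def by (smt (verit) half_gt_zero mem_Collect_eq)
    obtain F2 where F2: "finite F2" "\<And>x y. x \<notin> F2 \<Longrightarrow> y \<notin> F2 \<Longrightarrow> dist x y < R \<Longrightarrow> cmod (g x - g y) < d/2"
      using g d(1) \<open>R > 0\<close> unfolding higson_def by (smt (verit) half_gt_zero mem_Collect_eq)
    have "cmod (G (f x, g x) - G (f y, g y)) < \<epsilon>" if "x \<notin> F1 \<union> F2" "y \<notin> F1 \<union> F2" "dist x y < R" for x y
    proof -
      have "dist (f x, g x) (f y, g y) \<le> cmod (f x - f y) + cmod (g x - g y)"
        unfolding dist_prod_def dist_norm by (simp add: sqrt_sum_squares_le_sum)
      also have "\<dots> < d/2 + d/2" using that F1(2) F2(2) by (intro add_strict_mono) auto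
      finally show ?thesis using d(2) inK by (simp add: dist_norm)
    qed
    then show ?thesis using F1(1) F2(1) by (intro exI[of _ "F1 \<union> F2"]) auto
  qed
  ultimately show ?thesis unfolding higson_def by blast
qed

lemma higson_comp:
  assumes "f \<in> higson" "closed S" "continuous_on S G" "\<And>x. f x \<in> S"
  shows "(\<lambda>x. G (f x)) \<in> higson"
proof -
  have "(\<lambda>x. (\<lambda>p. G (fst p)) (f x, f x)) \<in> higson"
    using assms by (intro higson_comp2[where S = "S \<times> UNIV"] closed_Times continuous_on_compose2[OF assms(3)] continuous_intros) auto
  then show ?thesis by simp
qed

lemma higson_add: "f \<in> higson \<Longrightarrow> g \<in> higson \<Longrightarrow> (\<lambda>x. f x + g x) \<in> higson"
  using higson_comp2[of f g UNIV "\<lambda>p. fst p + snd p"] by (simp add: continuous_intros)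

lemma higson_mult: "f \<in> higson \<Longrightarrow> g \<in> higson \<Longrightarrow> (\<lambda>x. f x * g x) \<in> higson"
  using higson_comp2[of f g UNIV "\<lambda>p. fst p * snd p"] by (simp add: continuous_intros)

lemma higson_const: "(\<lambda>_. c) \<in> higson"
  unfolding higson_def by auto

lemma higson_scale: "f \<in> higson \<Longrightarrow> (\<lambda>x. c * f x) \<in> higson"
  by (intro higson_mult higson_const)

lemma higson_sum: "(\<And>i. i \<in> I \<Longrightarrow> f i \<in> higson) \<Longrightarrow> (\<lambda>x. \<Sum>i\<in>I. f i x) \<in> higson"
  by (induction I rule: infinite_finite_induct) (auto intro: higson_const higson_add)

lemma higson_finite_support:
  assumes "finite F" "\<And>x. x \<notin> F \<Longrightarrow> f x = 0"
  shows "f \<in> higson"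
proof -
  have "range f \<subseteq> insert 0 (f ` F)" using assms(2) by auto
  then have "bounded (range f)" using assms(1) by (intro finite_imp_bounded) (rule finite_subset, auto)
  then show ?thesis using assms unfolding higson_def by (auto intro!: exI[of _ F])
qed

lemma higson_inverse:
  assumes "f \<in> higson" "c > 0" "\<And>x. c \<le> cmod (f x)"
  shows "(\<lambda>x. inverse (f x)) \<in> higson"
proof (rule higson_comp[OF assms(1)])
  show "closed {z. c \<le> cmod z}" by (intro closed_Collect_le continuous_intros)
  show "continuous_on {z. c \<le> cmod z} inverse" using assms(2) by (intro continuous_intros) auto
qed (use assms(3) in auto)

lemma higson_cont: "f \<in> higson \<Longrightarrow> continuous_on UNIV G \<Longrightarrow> (\<lambda>x. G (f x)) \<in> higson"
  by (rule higson_comp[of f UNIV G]) auto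

section \<open>States on the uniform Roe algebra\<close>

definition bstate :: "('a::metric_space bop \<Rightarrow> complex) \<Rightarrow> bool" where
  "bstate \<Phi> \<longleftrightarrow>
     (\<forall>a\<in>Roe. \<forall>b\<in>Roe. \<Phi> (a + b) = \<Phi> a + \<Phi> b) \<and>
     (\<forall>a\<in>Roe. \<forall>c. \<Phi> (cscale c a) = c * \<Phi> a) \<and>
     (\<forall>a\<in>Roe. \<Phi> (adj a * a) \<in> \<real> \<and> 0 \<le> Re (\<Phi> (adj a * a))) \<and>
     \<Phi> 1 = 1"

lemma is_state_iff: "is_state \<phi> \<longleftrightarrow> bstate (\<lambda>a. \<phi> (mat_of a))"
  unfolding is_state_def bstate_def roe_eq
  by (simp add: plus_bop.rep_eq cscale.rep_eq times_bop.rep_eq adj.rep_eq one_bop.rep_eq)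

text \<open>\<open>F\<close> keeps matrix values because \<open>entire_ext\<close> is stated for
  matrices; these values lie in \<open>roe\<close>, so \<open>Bop\<close> brings them back
  faithfully.\<close>

definition bKMS :: "('a::metric_space \<Rightarrow> real) \<Rightarrow> real \<Rightarrow> ('a bop \<Rightarrow> complex) \<Rightarrow> bool" where
  "bKMS h \<beta> \<Phi> \<longleftrightarrow> bstate \<Phi> \<and>
     (\<forall>a\<in>Roe. \<forall>b\<in>Roe. \<forall>F. entire_ext h (mat_of b) F \<longrightarrow>
        \<Phi> (a * Bop (F (\<i> * of_real \<beta>))) = \<Phi> (b * a))"

lemma entire_ext_mat_of:
  assumes "entire_ext h b F"
  shows "mat_of (Bop (F z)) = F z" "Bop (F z) \<in> Roe"
proof -
  have F: "F z \<in> roe" using assms by (simp add: entire_ext_def)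
  then show *: "mat_of (Bop (F z)) = F z" by (intro Bop_inverse) (simp add: roe_def)
  show "Bop (F z) \<in> Roe" unfolding roe_iff[symmetric] * by (rule F)
qed

lemma is_KMS_iff: "is_KMS h \<beta> \<phi> \<longleftrightarrow> bKMS h \<beta> (\<lambda>a. \<phi> (mat_of a))"
  unfolding is_KMS_def bKMS_def is_state_iff roe_eq
  by (auto simp: times_bop.rep_eq entire_ext_mat_of)

lemma bstate_add: "bstate \<Phi> \<Longrightarrow> a \<in> Roe \<Longrightarrow> b \<in> Roe \<Longrightarrow> \<Phi> (a + b) = \<Phi> a + \<Phi> b"
  by (simp add: bstate_def)

lemma bstate_cscale: "bstate \<Phi> \<Longrightarrow> a \<in> Roe \<Longrightarrow> \<Phi> (cscale c a) = c * \<Phi> a"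
  by (simp add: bstate_def)

lemma bstate_positive: "bstate \<Phi> \<Longrightarrow> a \<in> Roe \<Longrightarrow> \<Phi> (adj a * a) \<in> \<real> \<and> 0 \<le> Re (\<Phi> (adj a * a))"
  by (simp add: bstate_def)

lemma bstate_one: "bstate \<Phi> \<Longrightarrow> \<Phi> 1 = 1"
  by (simp add: bstate_def)

lemma uminus_eq_cscale: "- a = cscale (-1) a"
  by transfer simp

lemma bstate_diff:
  assumes "bstate \<Phi>" "a \<in> Roe" "b \<in> Roe"
  shows "\<Phi> (a - b) = \<Phi> a - \<Phi> b"
  using bstate_add[OF assms(1,2) Roe_cscale[OF assms(3), of "-1"]] bstate_cscale[OF assms(1,3), of "-1"]
  by (simp flip: uminus_eq_cscale)

text \<open>The expansion behind the two facts that follow: l = 1 and l = \<i> show that \<Phi>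
  respects adjoints, and \<open>l = - \<Phi> a\<close> gives the Cauchy-Schwarz inequality against
  the unit.\<close>

lemma bstate_shift:
  assumes "bstate \<Phi>" "a \<in> Roe"
  shows "\<Phi> (adj (a + cscale l 1) * (a + cscale l 1))
    = \<Phi> (adj a * a) + l * \<Phi> (adj a) + cnj l * \<Phi> a + cnj l * l"
proof -
  have "adj (a + cscale l 1) * (a + cscale l 1)
      = adj a * a + cscale l (adj a) + cscale (cnj l) a + cscale (cnj l * l) 1"
    by (simp add: adj_add adj_cscale algebra_simps cscale_mult_left cscale_mult_right cscale_cscale cscale_add)
  then show ?thesis
    using assms by (simp add: bstate_add bstate_cscale bstate_one Roe_add Roe_mult Roe_adj Roe_cscale Roe_one)
qed

lemma bstate_adj:
  assumes "bstate \<Phi>" "a \<in> Roe"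
  shows "\<Phi> (adj a) = cnj (\<Phi> a)"
proof -
  have r: "\<Phi> (adj b * b) \<in> \<real>" if "b \<in> Roe" for b using bstate_positive[OF assms(1) that] by blast
  have "l * \<Phi> (adj a) + cnj l * \<Phi> a \<in> \<real>" for l
  proof -
    have "\<Phi> (adj (a + cscale l 1) * (a + cscale l 1)) - \<Phi> (adj a * a) - cnj l * l \<in> \<real>"
      using assms by (intro Reals_diff r Roe_add Roe_cscale Roe_one) (auto simp: complex_is_Real_iff)
    then show ?thesis by (simp add: bstate_shift[OF assms])
  qed
  \<comment> \<open>The case l = 1 compares imaginary parts, the case l = \<i> real parts.\<close>
  from this[of 1] this[of \<i>] show ?thesis
    by (simp add: complex_is_Real_iff complex_eq_iff)
qed

lemma bstate_Cauchy_Schwarz: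
  assumes "bstate \<Phi>" "a \<in> Roe"
  shows "(cmod (\<Phi> a))\<^sup>2 \<le> Re (\<Phi> (adj a * a))"
proof -
  define l where "l = - \<Phi> a"
  have "0 \<le> Re (\<Phi> (adj (a + cscale l 1) * (a + cscale l 1)))"
    using assms bstate_positive[OF assms(1)] by (simp add: Roe_add Roe_cscale Roe_one)
  also have "\<Phi> (adj (a + cscale l 1) * (a + cscale l 1)) = \<Phi> (adj a * a) - \<Phi> a * cnj (\<Phi> a)"
    by (simp add: bstate_shift[OF assms] bstate_adj[OF assms] l_def)
  finally show ?thesis by (simp add: complex_mult_cnj cmod_power2)
qed

text \<open>For t above the norm of \<open>x = adj a * a\<close>, the element
  \<open>1 - inverse t *\<^sub>R x\<close> is \<open>b * b\<close> with \<open>b\<close> selfadjoint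
  in \<open>Roe\<close>; positivity gives \<open>Re (\<Phi> x) \<le> t\<close>, and Cauchy-Schwarz
  passes from \<open>x\<close> to \<open>a\<close>. Taking t strictly larger makes the series
  converge.\<close>

lemma bstate_norm_le:
  assumes "bstate \<Phi>" "a \<in> Roe"
  shows "cmod (\<Phi> a) \<le> norm a"
proof -
  define x where "x = adj a * a"
  have x: "x \<in> Roe" "adj x = x" using assms by (auto simp: x_def Roe_mult Roe_adj adj_mult)
  have "Re (\<Phi> x) \<le> t" if "t > norm x" for t
  proof -
    have t: "t > 0" using that norm_ge_zero[of x] by linarith
    define y where "y = inverse t *\<^sub>R x"
    have y: "norm y < 1" "adj y = y" "y \<in> Roe"
      using that t x by (auto simp: y_def adj_scaleR Roe_scaleR divide_simps)
    from selfadjoint_sqrt[OF y(1,2) Roe_closed Roe_subspace Roe_power[OF y(3)]]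
    obtain b where b: "b \<in> Roe" "adj b = b" "b * b = 1 - y" by blast
    have "0 \<le> Re (\<Phi> (1 - y))" using bstate_positive[OF assms(1) b(1)] b by simp
    also have "\<Phi> (1 - y) = 1 - of_real (inverse t) * \<Phi> x"
      using bstate_diff[OF assms(1) Roe_one y(3)] bstate_cscale[OF assms(1) x(1)]
      by (simp add: y_def scaleR_eq_cscale bstate_one[OF assms(1)])
    finally show ?thesis using t by (simp add: field_simps)
  qed
  then have "Re (\<Phi> x) \<le> norm x" by (rule dense_ge)
  also have "\<dots> \<le> norm a * norm a" unfolding x_def using norm_mult_ineq[of "adj a" a] by simp
  finally have "(cmod (\<Phi> a))\<^sup>2 \<le> (norm a)\<^sup>2"
    using bstate_Cauchy_Schwarz[OF assms] by (simp add: x_def power2_eq_square)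
  then show ?thesis by (rule power2_le_imp_le) simp
qed

lemma bounded_range_of_real:
  assumes "\<And>x. \<bar>u x\<bar> \<le> C"
  shows "bounded (range (\<lambda>x. complex_of_real (u x)))"
  unfolding bounded_range_iff using assms by (auto intro!: exI[of _ C])

text \<open>The pointwise square root of \<open>u\<close> is again bounded, so it gives a
  selfadjoint diagonal element of the Roe algebra whose square is the operator in question.\<close>

lemma bstate_diag_nonneg:
  assumes "bstate \<Phi>" "\<And>x. 0 \<le> u x" "bounded (range (\<lambda>x. complex_of_real (u x)))"
  shows "\<Phi> (dg (\<lambda>x. of_real (u x))) \<in> \<real> \<and> 0 \<le> Re (\<Phi> (dg (\<lambda>x. of_real (u x))))"
proof -
  from assms(3) obtain C where C: "\<And>x. \<bar>u x\<bar> \<le> C" unfolding bounded_range_iff by auto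
  have b: "bounded (range (\<lambda>x. complex_of_real (sqrt (u x))))"
  proof (rule bounded_range_of_real)
    show "\<bar>sqrt (u x)\<bar> \<le> sqrt C" for x using C[of x] assms(2)[of x] by simp
  qed
  have "dg (\<lambda>x. of_real (u x)) = dg (\<lambda>x. of_real (sqrt (u x))) * dg (\<lambda>x. of_real (sqrt (u x)))"
    unfolding dg_mult[OF b b, symmetric] using assms(2) by (simp flip: of_real_mult)
  then show ?thesis
    using bstate_positive[OF assms(1) dg_Roe[OF b]] by (simp add: adj_dg_real[OF b])
qed

lemma dg_diff:
  assumes "bounded (range f)" "bounded (range g)"
  shows "dg (\<lambda>x. f x - g x) = dg f - dg g"
proof -
  have "bounded (range (\<lambda>x. -1 * g x))" using assms(2) by (intro bounded_range_mult) auto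
  from dg_add[OF assms(1) this] dg_cscale[OF assms(2), of "-1"] show ?thesis
    by (simp flip: uminus_eq_cscale)
qed

lemma bstate_diag_mono:
  assumes "bstate \<Phi>" "\<And>x. u x \<le> v x" "bounded (range (\<lambda>x. complex_of_real (u x)))"
    "bounded (range (\<lambda>x. complex_of_real (v x)))"
  shows "Re (\<Phi> (dg (\<lambda>x. of_real (u x)))) \<le> Re (\<Phi> (dg (\<lambda>x. of_real (v x))))"
proof -
  have d: "dg (\<lambda>x. complex_of_real (v x - u x)) = dg (\<lambda>x. of_real (v x)) - dg (\<lambda>x. of_real (u x))"
    using dg_diff[OF assms(4,3)] by simp
  have "bounded (range (\<lambda>x. complex_of_real (v x - u x)))"
    unfolding of_real_diff by (rule bounded_minus_comp[OF assms(4,3)])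
  from bstate_diag_nonneg[OF assms(1) _ this] assms(2)
  have "0 \<le> Re (\<Phi> (dg (\<lambda>x. complex_of_real (v x - u x))))" by simp
  then show ?thesis unfolding d using bstate_diff[OF assms(1) dg_Roe[OF assms(4)] dg_Roe[OF assms(3)]] by simp
qed

text \<open>Positivity and the KMS condition survive because Higson functions are central modulo the
  compacts.\<close>
lemma bKMS_reweight:
  fixes u :: "'a::metric_space \<Rightarrow> real"
  assumes ulf: "ulf TYPE('a)" and kms: "bKMS h \<beta> \<Phi>" and van: "\<And>k. k \<in> Cpt \<Longrightarrow> \<Phi> k = 0"
    and u: "(\<lambda>x. of_real (u x)) \<in> higson"
  defines "D \<equiv> dg (\<lambda>x. of_real (u x * u x))"
  assumes nz: "\<Phi> D \<noteq> 0"
  shows "bKMS h \<beta> (\<lambda>a. \<Phi> (D * a) / \<Phi> D)"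
proof -
  have st: "bstate \<Phi>" using kms by (simp add: bKMS_def)
  have bu: "bounded (range (\<lambda>x. complex_of_real (u x)))" by (rule higson_bounded[OF u])
  define G where "G = dg (\<lambda>x. complex_of_real (u x))"
  have G: "G \<in> Roe" "adj G = G" unfolding G_def by (rule dg_Roe[OF bu], rule adj_dg_real[OF bu])
  have D_eq: "D = G * G" unfolding D_def G_def dg_mult[OF bu bu, symmetric] by simp
  have D_higson: "(\<lambda>x. complex_of_real (u x * u x)) \<in> higson" using higson_mult[OF u u] by simp
  have D: "D \<in> Roe" unfolding D_eq by (rule Roe_mult[OF G(1) G(1)])
  have Dpos: "\<Phi> D \<in> \<real>" "0 \<le> Re (\<Phi> D)"
    using bstate_positive[OF st G(1)] by (simp_all add: G(2) D_eq)
  have pos: "\<Phi> (D * (adj a * a)) / \<Phi> D \<in> \<real> \<and> 0 \<le> Re (\<Phi> (D * (adj a * a)) / \<Phi> D)" if a: "a \<in> Roe" for a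
  proof -
    define x where "x = adj a * a"
    have x: "x \<in> Roe" using a by (simp add: x_def Roe_mult Roe_adj)
    \<comment> \<open>This is why the weight is a square: one factor \<open>G\<close> moves to the
      far right modulo compacts, which leaves \<open>adj (a * G) * (a * G)\<close>.\<close>
    have "G * (G * x) - (G * x) * G \<in> Cpt"
      unfolding G_def by (rule commutator_Cpt[OF ulf u]) (use x G in \<open>simp add: G_def Roe_mult\<close>)
    then have "\<Phi> (G * (G * x)) = \<Phi> ((G * x) * G)"
      using van bstate_diff[OF st, of "G * (G * x)" "(G * x) * G"] G x by (simp add: Roe_mult)
    also have "(G * x) * G = adj (a * G) * (a * G)" by (simp add: adj_mult G(2) x_def mult.assoc)
    finally have "\<Phi> (D * x) = \<Phi> (adj (a * G) * (a * G))" by (simp add: D_eq mult.assoc)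
    moreover have "\<Phi> (adj (a * G) * (a * G)) \<in> \<real> \<and> 0 \<le> Re (\<Phi> (adj (a * G) * (a * G)))"
      by (rule bstate_positive[OF st]) (simp add: a G Roe_mult)
    ultimately show ?thesis using Dpos
      by (auto simp: x_def complex_is_Real_iff Re_divide Im_divide)
  qed
  have state: "bstate (\<lambda>a. \<Phi> (D * a) / \<Phi> D)"
    unfolding bstate_def
    using pos nz by (auto simp: distrib_left bstate_add[OF st] bstate_cscale[OF st] D Roe_mult
        cscale_mult_right add_divide_distrib)
  have "\<Phi> (D * (a * Bop (F (\<i> * of_real \<beta>)))) = \<Phi> (D * (b * a))"
    if a: "a \<in> Roe" and b: "b \<in> Roe" and F: "entire_ext h (mat_of b) F" for a b F
  proof -
    \<comment> \<open>The weight is absorbed into the free argument of the KMS identity for \<Phi>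
      and afterwards commuted past \<open>b\<close> modulo compacts.\<close>
    have "\<Phi> (D * a * Bop (F (\<i> * of_real \<beta>))) = \<Phi> (b * (D * a))"
      using kms Roe_mult[OF D a] b F unfolding bKMS_def by blast
    moreover have "(D * b - b * D) * a \<in> Cpt"
      unfolding D_def by (intro Cpt_mult_right[OF ulf] commutator_Cpt[OF ulf D_higson] a b)
    then have "\<Phi> (D * b * a) = \<Phi> (b * D * a)"
      using van bstate_diff[OF st, of "D * b * a" "b * D * a"] D a b by (simp add: Roe_mult left_diff_distrib)
    ultimately show ?thesis by (simp add: mult.assoc)
  qed
  then show ?thesis unfolding bKMS_def using state by simp
qed

section \<open>Characters of the Higson algebra\<close>

lemma hX_add: "\<omega> \<in> hX \<Longrightarrow> f \<in> higson \<Longrightarrow> g \<in> higson \<Longrightarrow> \<omega> (\<lambda>x. f x + g x) = \<omega> f + \<omega> g"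
  by (simp add: hX_def)

lemma hX_scale: "\<omega> \<in> hX \<Longrightarrow> f \<in> higson \<Longrightarrow> \<omega> (\<lambda>x. c * f x) = c * \<omega> f"
  by (simp add: hX_def)

lemma hX_mult: "\<omega> \<in> hX \<Longrightarrow> f \<in> higson \<Longrightarrow> g \<in> higson \<Longrightarrow> \<omega> (\<lambda>x. f x * g x) = \<omega> f * \<omega> g"
  by (simp add: hX_def)

lemma hX_const: "\<omega> \<in> hX \<Longrightarrow> \<omega> (\<lambda>x. c) = c"
  using hX_scale[of \<omega> "\<lambda>_. 1" c] by (simp add: higson_const hX_def)

lemma hX_sum:
  assumes "\<omega> \<in> hX" "\<And>i. i \<in> I \<Longrightarrow> f i \<in> higson"
  shows "\<omega> (\<lambda>x. \<Sum>i\<in>I. f i x) = (\<Sum>i\<in>I. \<omega> (f i))"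
  using assms(2)
  by (induction I rule: infinite_finite_induct)
    (auto simp: hX_const[OF assms(1)] hX_add[OF assms(1)] higson_sum)

lemma hX_diff_const:
  assumes "\<omega> \<in> hX" "f \<in> higson"
  shows "(\<lambda>x. f x - c) \<in> higson" "\<omega> (\<lambda>x. f x - c) = \<omega> f - c"
  using higson_add[OF assms(2) higson_const[of "-c"]] hX_add[OF assms higson_const[of "-c"]]
    hX_const[OF assms(1), of "-c"] by simp_all

text \<open>Such an \<open>f\<close> is invertible inside the Higson functions, and a character
  cannot vanish on an invertible element.\<close>

lemma hX_nonzero:
  assumes "\<omega> \<in> hX" "f \<in> higson" "c > 0" "\<And>x. c \<le> cmod (f x)"
  shows "\<omega> f \<noteq> 0"
proof
  assume "\<omega> f = 0"
  then have "\<omega> (\<lambda>x. f x * inverse (f x)) = 0"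
    by (simp add: hX_mult[OF assms(1,2) higson_inverse[OF assms(2-4)]])
  moreover have "f x * inverse (f x) = 1" for x
    using assms(3) assms(4)[of x] by (intro right_inverse) auto
  ultimately show False using hX_const[OF assms(1), of 1] by simp
qed

text \<open>The definition of \<open>hX\<close> does not mention conjugation, so reality is derived:
  a nonreal value l would make \<open>u - l\<close> bounded below by \<open>\<bar>Im l\<bar>\<close>
  and yet annihilated by \<omega>.\<close>

lemma hX_real:
  assumes "\<omega> \<in> hX" "(\<lambda>x. complex_of_real (u x)) \<in> higson"
  shows "\<omega> (\<lambda>x. of_real (u x)) \<in> \<real>"
proof (rule ccontr)
  define l where "l = \<omega> (\<lambda>x. complex_of_real (u x))"
  assume "\<omega> (\<lambda>x. of_real (u x)) \<notin> \<real>"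
  then have im: "Im l \<noteq> 0" by (simp add: l_def complex_is_Real_iff)
  have "\<omega> (\<lambda>x. of_real (u x) - l) \<noteq> 0"
  proof (rule hX_nonzero[OF assms(1) hX_diff_const(1)[OF assms]])
    show "\<bar>Im l\<bar> \<le> cmod (of_real (u x) - l)" for x
      using abs_Im_le_cmod[of "of_real (u x) - l"] by simp
  qed (use im in simp)
  then show False using hX_diff_const(2)[OF assms, of l] by (simp add: l_def)
qed

lemma ev_hX: "ev p \<in> hX"
  unfolding hX_def ev_def by (auto simp: higson_add higson_mult higson_scale higson_const)

text \<open>\<open>k\<close> sums \<open>|f - \<omega> f|^2 / \<epsilon>^2\<close> over the finitely
  many functions describing the neighbourhood. Each summand contains the factor
  \<open>f - \<omega> f\<close>, which \<omega> kills; and if \<open>k p < 1\<close> then every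
  summand is below 1, which puts \<open>ev p\<close> into \<open>U\<close>.\<close>

lemma nhd_separation:
  assumes om: "\<omega> \<in> hX" and U: "hX_nhd \<omega> U"
  obtains k :: "'a::metric_space \<Rightarrow> real"
  where "(\<lambda>x. of_real (k x)) \<in> higson" "\<omega> (\<lambda>x. of_real (k x)) = 0"
    "\<And>p. 0 \<le> k p" "\<And>p. ev p \<notin> U \<Longrightarrow> 1 \<le> k p"
proof -
  obtain F \<epsilon> where F: "finite F" "F \<subseteq> higson" "\<epsilon> > 0" "{\<eta>\<in>hX. \<forall>f\<in>F. cmod (\<eta> f - \<omega> f) < \<epsilon>} \<subseteq> U"
    using U unfolding hX_nhd_def by blast
  define k where "k p = (\<Sum>f\<in>F. (cmod (f p - \<omega> f))\<^sup>2 / \<epsilon>\<^sup>2)" for p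
  define t where "t f = (\<lambda>x. (f x - \<omega> f) * (cnj (f x - \<omega> f) * of_real (1 / \<epsilon>\<^sup>2)))" for f :: "'a \<Rightarrow> complex"
  have k_eq: "complex_of_real (k p) = (\<Sum>f\<in>F. t f p)" for p
    unfolding k_def t_def of_real_sum
    by (intro sum.cong refl) (simp add: complex_norm_square mult.assoc del: of_real_power)
  have d: "(\<lambda>x. f x - \<omega> f) \<in> higson" "\<omega> (\<lambda>x. f x - \<omega> f) = 0"
    and d2: "(\<lambda>x. cnj (f x - \<omega> f) * of_real (1 / \<epsilon>\<^sup>2)) \<in> higson" if "f \<in> F" for f
  proof -
    have f: "f \<in> higson" using that F(2) by blast
    show d: "(\<lambda>x. f x - \<omega> f) \<in> higson" "\<omega> (\<lambda>x. f x - \<omega> f) = 0"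
      using hX_diff_const[OF om f, of "\<omega> f"] by simp_all
    show "(\<lambda>x. cnj (f x - \<omega> f) * of_real (1 / \<epsilon>\<^sup>2)) \<in> higson"
      by (rule higson_mult[OF higson_cont[OF d(1)] higson_const]) (intro continuous_intros)
  qed
  have t: "t f \<in> higson" "\<omega> (t f) = 0" if "f \<in> F" for f
    unfolding t_def using higson_mult[OF d(1)[OF that] d2[OF that]] hX_mult[OF om d(1)[OF that] d2[OF that]] d(2)[OF that]
    by simp_all
  show thesis
  proof (rule that[of k])
    show "(\<lambda>x. of_real (k x)) \<in> higson" unfolding k_eq by (rule higson_sum[OF t(1)])
    show "\<omega> (\<lambda>x. of_real (k x)) = 0" unfolding k_eq using hX_sum[OF om, of F t] t by simp
    show "0 \<le> k p" for p unfolding k_def by (intro sum_nonneg) auto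
    show "1 \<le> k p" if "ev p \<notin> U" for p
    proof (rule ccontr)
      assume k: "\<not> 1 \<le> k p"
      have "cmod (ev p f - \<omega> f) < \<epsilon>" if f: "f \<in> F" for f
      proof -
        have "(cmod (f p - \<omega> f))\<^sup>2 / \<epsilon>\<^sup>2 \<le> k p"
          unfolding k_def using F(1) f by (intro member_le_sum) auto
        then have "(cmod (f p - \<omega> f))\<^sup>2 / \<epsilon>\<^sup>2 < 1" using k by linarith
        then have "(cmod (f p - \<omega> f))\<^sup>2 < \<epsilon>\<^sup>2" using F(3) by simp
        then have "cmod (f p - \<omega> f) < \<epsilon>" by (rule power2_less_imp_less) (use F(3) in simp)
        then show ?thesis using f F(2) by (auto simp: ev_def)
      qed
      then have "ev p \<in> U" using F(4) ev_hX by blast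
      then show False using that by simp
    qed
  qed
qed

section \<open>Extreme KMS states\<close>

text \<open>With s the value of \<Phi> at \<open>D\<close>, \<Phi> is the convex combination with
  weights s and 1 - s of its reweightings by \<open>D\<close> and \<open>1 - D\<close>. The bounds
  on \<open>r\<close> force s into [1/3, 2/3], so both normalisations make sense and extremality
  applies: the first reweighting equals \<Phi>, which is the claim.\<close>

lemma extreme_central:
  fixes \<phi> :: "'a::metric_space mat \<Rightarrow> complex"
  assumes ulf: "ulf TYPE('a)" and ext: "is_extreme_KMS h \<beta> \<phi>" and van: "vanishes_on_compacts \<phi>"
    and r: "(\<lambda>x. of_real (r x)) \<in> higson" "\<And>x. 1/3 \<le> r x" "\<And>x. r x \<le> 2/3" and a: "a \<in> Roe"
  shows "\<phi> (mat_of (dg (\<lambda>x. of_real (r x)) * a)) = \<phi> (mat_of (dg (\<lambda>x. of_real (r x)))) * \<phi> (mat_of a)"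
proof -
  define \<Phi> where "\<Phi> a = \<phi> (mat_of a)" for a
  have kms: "bKMS h \<beta> \<Phi>" using ext unfolding is_extreme_KMS_def is_KMS_iff \<Phi>_def by blast
  then have st: "bstate \<Phi>" by (simp add: bKMS_def)
  have van': "\<And>k. k \<in> Cpt \<Longrightarrow> \<Phi> k = 0"
    using van unfolding vanishes_on_compacts_def \<Phi>_def compacts_iff[symmetric] by blast
  have br: "bounded (range (\<lambda>x. complex_of_real (r x)))" by (rule higson_bounded[OF r(1)])
  have r': "(\<lambda>x. complex_of_real (1 - r x)) \<in> higson"
    using higson_add[OF higson_const[of 1] higson_scale[OF r(1), of "-1"]] by simp
  \<comment> \<open>Reweighting takes a squared weight, so \<open>r\<close> and \<open>1 - r\<close>
    enter through their square roots.\<close>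
  have sqrt_higson: "(\<lambda>x. complex_of_real (sqrt (v x))) \<in> higson" if "(\<lambda>x. complex_of_real (v x)) \<in> higson" for v
    using higson_cont[OF that, of "\<lambda>z. of_real (sqrt (Re z))"] by (simp add: continuous_intros)
  define D where "D = dg (\<lambda>x. complex_of_real (r x))"
  have D: "D \<in> Roe" unfolding D_def by (rule dg_Roe[OF br])
  have D': "dg (\<lambda>x. complex_of_real (1 - r x)) = 1 - D"
    unfolding D_def one_eq_dg using dg_diff[OF _ br, of "\<lambda>_. 1"] by simp
  define s where "s = Re (\<Phi> D)"
  have Ds: "\<Phi> D = of_real s"
    using bstate_diag_nonneg[OF st _ br] order_trans[OF _ r(2), of 0] by (simp add: D_def s_def)
  have cst: "Re (\<Phi> (dg (\<lambda>x. complex_of_real c))) = c" for c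
    using dg_cscale[of "\<lambda>_ :: 'a. 1" "of_real c"] bstate_cscale[OF st Roe_one, of "of_real c"] bstate_one[OF st]
    by (simp add: one_eq_dg)
  have s: "1/3 \<le> s" "s \<le> 2/3"
    using bstate_diag_mono[OF st, of "\<lambda>_. 1/3" r] bstate_diag_mono[OF st, of r "\<lambda>_. 2/3"] r br
    by (simp_all only: cst D_def s_def bounded_range_of_real[OF order_refl])
  have D's: "\<Phi> (1 - D) = of_real (1 - s)"
    by (simp add: bstate_diff[OF st Roe_one D] bstate_one[OF st] Ds)
  have sq: "sqrt (r x) * sqrt (r x) = r x" "sqrt (1 - r x) * sqrt (1 - r x) = 1 - r x" for x
    using r(2,3)[of x] by simp_all
  have K1: "bKMS h \<beta> (\<lambda>a. \<Phi> (D * a) / \<Phi> D)"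
    using bKMS_reweight[OF ulf kms van' sqrt_higson[OF r(1)]] s unfolding sq D_def[symmetric] by (simp add: Ds)
  have K2: "bKMS h \<beta> (\<lambda>a. \<Phi> ((1 - D) * a) / \<Phi> (1 - D))"
    using bKMS_reweight[OF ulf kms van' sqrt_higson[OF r']] s unfolding sq D' by (simp add: D's)
  define \<phi>1 where "\<phi>1 a = \<Phi> (D * Bop a) / \<Phi> D" for a
  define \<phi>2 where "\<phi>2 a = \<Phi> ((1 - D) * Bop a) / \<Phi> (1 - D)" for a
  have "is_KMS h \<beta> \<phi>1" "is_KMS h \<beta> \<phi>2"
    using K1 K2 unfolding is_KMS_iff \<phi>1_def \<phi>2_def by (simp_all add: mat_of_inverse)
  moreover have "\<forall>a\<in>roe. \<phi> a = of_real s * \<phi>1 a + of_real (1 - s) * \<phi>2 a"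
  proof
    fix a :: "'a mat" assume "a \<in> roe"
    then obtain b where b: "b \<in> Roe" "a = mat_of b" unfolding roe_eq by blast
    have "\<Phi> b = \<Phi> (D * b + (1 - D) * b)" by (simp add: algebra_simps)
    also have "\<dots> = \<Phi> (D * b) + \<Phi> ((1 - D) * b)"
      by (intro bstate_add[OF st] Roe_mult Roe_diff Roe_one D b)
    also have "\<dots> = of_real s * \<phi>1 a + of_real (1 - s) * \<phi>2 a"
      using s by (simp only: \<phi>1_def \<phi>2_def b(2) mat_of_inverse Ds D's) simp
    finally show "\<phi> a = of_real s * \<phi>1 a + of_real (1 - s) * \<phi>2 a" by (simp add: \<Phi>_def b(2))
  qed
  moreover have "0 < s" "s < 1" using s by simp_all
  ultimately have "\<forall>a\<in>roe. \<phi>1 a = \<phi> a \<and> \<phi>2 a = \<phi> a"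
    using ext unfolding is_extreme_KMS_def by blast
  then have "\<phi>1 (mat_of a) = \<Phi> a" using a by (simp add: \<Phi>_def roe_iff)
  then have "\<Phi> (D * a) = \<Phi> D * \<Phi> a" using s by (auto simp: \<phi>1_def mat_of_inverse Ds divide_eq_eq mult.commute)
  then show ?thesis by (simp add: \<Phi>_def D_def)
qed

text \<open>The operators satisfying the identity form a complex linear space \<open>M\<close>
  containing 1, and every Higson function is a combination of 1 and Higson functions with values in
  [1/3, 2/3].\<close>

lemma extreme_multiplicative:
  fixes \<phi> :: "'a::metric_space mat \<Rightarrow> complex"
  assumes ulf: "ulf TYPE('a)" and ext: "is_extreme_KMS h \<beta> \<phi>" and van: "vanishes_on_compacts \<phi>"
    and f: "f \<in> higson" and a: "a \<in> Roe"
  shows "\<phi> (mat_of (dg f * a)) = \<phi> (mat_of (dg f)) * \<phi> (mat_of a)"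
proof -
  define \<Phi> where "\<Phi> a = \<phi> (mat_of a)" for a
  have st: "bstate \<Phi>"
    using ext unfolding is_extreme_KMS_def is_KMS_iff \<Phi>_def bKMS_def by blast
  define M where "M = {d\<in>Roe. \<forall>a\<in>Roe. \<Phi> (d * a) = \<Phi> d * \<Phi> a}"
  have M_one: "1 \<in> M" by (simp add: M_def Roe_one bstate_one[OF st])
  have M_add: "c + d \<in> M" if "c \<in> M" "d \<in> M" for c d
    using that by (simp add: M_def Roe_add Roe_mult distrib_right bstate_add[OF st])
  have M_cscale: "cscale l d \<in> M" if "d \<in> M" for l d
    using that by (simp add: M_def Roe_cscale Roe_mult cscale_mult_left bstate_cscale[OF st])
  have M_real: "dg (\<lambda>x. complex_of_real (u x)) \<in> M" if u: "(\<lambda>x. complex_of_real (u x)) \<in> higson" for u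
  proof -
    from higson_bounded[OF u] obtain C where C: "\<And>x. \<bar>u x\<bar> \<le> C" unfolding bounded_range_iff by auto
    \<comment> \<open>Then \<open>\<bar>u x / K\<bar>\<close> is at most 1/6, the distance from 1/2
      to 1/3 and to 2/3. The summand 1 keeps \<open>K\<close> positive.\<close>
    define K where "K = 6 * (\<bar>C\<bar> + 1)"
    have K: "K > 0" by (simp add: K_def)
    define r where "r x = 1/2 + u x / K" for x
    have uK: "\<bar>u x / K\<bar> \<le> 1/6" for x
    proof -
      have "6 * \<bar>u x\<bar> \<le> K" using order_trans[OF C[of x] abs_ge_self] by (simp add: K_def)
      then show ?thesis using K by (simp add: abs_divide divide_le_eq)
    qed
    have r: "(\<lambda>x. complex_of_real (r x)) \<in> higson"
      using higson_add[OF higson_const[of "1/2"] higson_scale[OF u, of "1 / of_real K"]] by (simp add: r_def)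
    have "dg (\<lambda>x. complex_of_real (r x)) \<in> M"
      unfolding M_def \<Phi>_def
    proof (intro CollectI conjI ballI extreme_central[OF ulf ext van r] dg_Roe higson_bounded r)
      show "1/3 \<le> r x" "r x \<le> 2/3" for x
        using abs_le_D1[OF uK[of x]] abs_le_D2[OF uK[of x]] unfolding r_def by linarith+
    qed
    then have "cscale (of_real K) (dg (\<lambda>x. complex_of_real (r x))) + cscale (- of_real K / 2) 1 \<in> M"
      by (intro M_add M_cscale M_one)
    also have "cscale (of_real K) (dg (\<lambda>x. complex_of_real (r x))) + cscale (- of_real K / 2) 1
        = dg (\<lambda>x. of_real K * complex_of_real (r x) + (- of_real K / 2) * 1)"
      unfolding one_eq_dg
      by (subst dg_add) (simp_all only: dg_cscale higson_bounded r higson_const higson_scale)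
    also have "\<dots> = dg (\<lambda>x. complex_of_real (u x))"
      using K by (intro arg_cong[where f = dg] ext) (simp add: r_def field_simps)
    finally show ?thesis .
  qed
  have re: "(\<lambda>x. complex_of_real (Re (f x))) \<in> higson" and im: "(\<lambda>x. complex_of_real (Im (f x))) \<in> higson"
    using higson_cont[OF f, of "\<lambda>z. of_real (Re z)"] higson_cont[OF f, of "\<lambda>z. of_real (Im z)"]
    by (simp_all add: continuous_intros)
  have "dg f = dg (\<lambda>x. complex_of_real (Re (f x)) + \<i> * complex_of_real (Im (f x)))"
    by (simp flip: complex_eq)
  also have "\<dots> = dg (\<lambda>x. of_real (Re (f x))) + cscale \<i> (dg (\<lambda>x. of_real (Im (f x))))"
    by (subst dg_add) (simp_all only: dg_cscale higson_bounded re im higson_scale)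
  also have "\<dots> \<in> M" by (intro M_add M_cscale M_real re im)
  finally show ?thesis using a unfolding M_def \<Phi>_def by blast
qed

lemma mat_of_chi: "mat_of (dg (\<lambda>x. of_real (if x \<in> A then 1 else 0))) = chi A"
  unfolding chi_def by (subst mat_of_dg) (auto intro!: bounded_range_of_real[of _ 1] arg_cong[where f = diag])

text \<open>The supporting point is \<phi> itself, restricted to diagonal Higson functions. It is
  not evaluation at a point of the space, because the projection onto that point is both Higson and
  compact.\<close>

lemma extreme_supported:
  fixes \<phi> :: "'a::metric_space mat \<Rightarrow> complex"
  assumes ulf: "ulf TYPE('a)" and ext: "is_extreme_KMS h \<beta> \<phi>" and van: "vanishes_on_compacts \<phi>"
  shows "\<exists>\<omega>\<in>nuX. supported_on \<phi> \<omega>"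
proof -
  define \<Phi> where "\<Phi> a = \<phi> (mat_of a)" for a
  have st: "bstate \<Phi>"
    using ext unfolding is_extreme_KMS_def is_KMS_iff \<Phi>_def bKMS_def by blast
  define \<omega> where "\<omega> f = (if f \<in> higson then \<Phi> (dg f) else 0)" for f
  note b = higson_bounded
  have hX: "\<omega> \<in> hX"
    unfolding hX_def
  proof (intro CollectI conjI allI ballI impI)
    fix f g :: "'a \<Rightarrow> complex" and c
    show "\<omega> f = 0" if "f \<notin> higson" using that by (simp add: \<omega>_def)
    show "\<omega> (\<lambda>x. 1) = 1" by (simp add: \<omega>_def higson_const bstate_one[OF st] flip: one_eq_dg)
    assume f: "f \<in> higson"
    show "\<omega> (\<lambda>x. c * f x) = c * \<omega> f"
      by (simp add: \<omega>_def f higson_scale dg_cscale b dg_Roe bstate_cscale[OF st])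
    assume g: "g \<in> higson"
    show "\<omega> (\<lambda>x. f x + g x) = \<omega> f + \<omega> g"
      by (simp add: \<omega>_def f g higson_add dg_add b dg_Roe bstate_add[OF st])
    show "\<omega> (\<lambda>x. f x * g x) = \<omega> f * \<omega> g"
      using extreme_multiplicative[OF ulf ext van f dg_Roe[OF b[OF g]]]
      by (simp add: \<omega>_def f g higson_mult dg_mult b \<Phi>_def)
  qed
  have "\<omega> \<noteq> ev p" for p
  proof
    assume eq: "\<omega> = ev p"
    define f where "f x = (if x = p then 1 else 0 :: complex)" for x
    have f: "f \<in> higson" by (rule higson_finite_support[of "{p}"]) (auto simp: f_def)
    have "dg f \<in> fin_supp"
      unfolding fin_supp_def mem_Collect_eq mat_of_dg[OF b[OF f]]
      by (rule finite_subset[of _ "{(p, p)}"]) (auto simp: diag_def f_def split: if_splits)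
    then have "dg f \<in> Cpt" unfolding Cpt_def using closure_subset by blast
    then have "\<omega> f = 0"
      using van f unfolding vanishes_on_compacts_def \<omega>_def \<Phi>_def compacts_iff[symmetric] by simp
    then show False using f by (simp add: eq ev_def) (simp add: f_def)
  qed
  then have "\<omega> \<in> nuX" using hX by (auto simp: nuX_def)
  moreover have "supported_on \<phi> \<omega>"
    unfolding supported_on_def
  proof (intro allI impI)
    fix U assume "hX_nhd \<omega> U"
    from nhd_separation[OF hX this] obtain k where k: "(\<lambda>x. complex_of_real (k x)) \<in> higson"
      "\<omega> (\<lambda>x. of_real (k x)) = 0" "\<And>p. 0 \<le> k p" "\<And>p. ev p \<notin> U \<Longrightarrow> 1 \<le> k p" by blast
    define A where "A = {p. ev p \<in> U}"
    define c where "c p = (if p \<in> A then 1 else 0 :: real)" for p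
    have bc: "bounded (range (\<lambda>x. complex_of_real (c x)))" by (rule bounded_range_of_real[of _ 1]) (simp add: c_def)
    have bc': "bounded (range (\<lambda>x. complex_of_real (1 - c x)))" by (rule bounded_range_of_real[of _ 1]) (simp add: c_def)
    \<comment> \<open>Outside the neighbourhood \<open>k\<close> is at least 1, so it dominates the
      complementary projection, and \<Phi> vanishes on \<open>k\<close>.\<close>
    have "\<Phi> (dg (\<lambda>x. of_real (1 - c x))) = 0"
    proof -
      have "Re (\<Phi> (dg (\<lambda>x. of_real (1 - c x)))) \<le> Re (\<Phi> (dg (\<lambda>x. of_real (k x))))"
        by (rule bstate_diag_mono[OF st _ bc' b[OF k(1)]]) (use k(3,4) in \<open>auto simp: c_def A_def\<close>)
      also have "\<dots> = 0" using k(1,2) by (simp add: \<omega>_def)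
      finally show ?thesis
        using bstate_diag_nonneg[OF st _ bc'] by (simp add: c_def complex_is_Real_iff complex_eq_iff)
    qed
    moreover have "dg (\<lambda>x. complex_of_real (1 - c x)) = 1 - dg (\<lambda>x. of_real (c x))"
      unfolding one_eq_dg using dg_diff[OF _ bc, of "\<lambda>_. 1"] by simp
    ultimately have "\<Phi> (dg (\<lambda>x. of_real (c x))) = 1"
      using bstate_diff[OF st Roe_one dg_Roe[OF bc]] by (simp add: bstate_one[OF st])
    then show "\<phi> (chi {p. ev p \<in> U}) = 1"
      unfolding \<Phi>_def c_def mat_of_chi by (simp add: A_def)
  qed
  ultimately show ?thesis by blast
qed

section \<open>KMS states supported on a given point\<close>

text \<open>The KMS conditions look only at \<open>Roe\<close>, which leaves values elsewhere free
  to be set to 0 for the compactness argument.\<close>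

lemma bKMS_cong:
  assumes "bKMS h \<beta> \<Phi>" "\<And>a. a \<in> Roe \<Longrightarrow> \<Psi> a = \<Phi> a"
  shows "bKMS h \<beta> \<Psi>"
  using assms(1) unfolding bKMS_def bstate_def
  by (simp add: assms(2) Roe_add Roe_cscale Roe_mult Roe_adj Roe_one entire_ext_mat_of)

text \<open>In the product topology evaluation at a fixed operator is continuous, and for fixed
  operators and a fixed extension \<open>F\<close> each clause compares a few such
  evaluations.\<close>

lemma closed_KMS: "closed {\<psi>. is_KMS h \<beta> \<psi>}"
  unfolding is_KMS_def is_state_def Ball_def complex_is_Real_iff
  by (intro closed_Collect_conj closed_Collect_all closed_Collect_imp closed_Collect_eq closed_Collect_le
      open_Collect_const continuous_intros continuous_on_product_coordinates)

text \<open>Compact by Tychonoff. The radius \<open>opnorm a\<close> comes from contractivity of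
  states; off \<open>roe\<close>, where a state is unconstrained, the value is pinned to 0.\<close>

definition state_box :: "('a::metric_space mat \<Rightarrow> complex) set" where
  "state_box = PiE UNIV (\<lambda>a. if a \<in> roe then cball 0 (opnorm a) else {0})"

lemma compact_state_box: "compact state_box"
proof -
  have "compactin (product_topology (\<lambda>_. euclidean) UNIV) (state_box :: ('a mat \<Rightarrow> complex) set)"
    unfolding state_box_def compactin_PiE by auto
  then show ?thesis by (simp add: euclidean_product_topology)
qed

text \<open>The finite case of the compactness argument. One weight \<open>g * g\<close> serves all
  neighbourhoods in \<open>N\<close>, since \<open>l\<close>, the sum of their separating functions,
  is at least 1 wherever one of them is missed.\<close>

lemma localized_KMS:
  fixes \<phi> :: "'a::metric_space mat \<Rightarrow> complex"
  assumes ulf: "ulf TYPE('a)" and kms: "is_KMS h \<beta> \<phi>" and van: "vanishes_on_compacts \<phi>"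
    and faithful: "faithful_on_CnuX \<phi>" and om: "\<omega> \<in> nuX"
    and N: "finite N" "\<And>U. U \<in> N \<Longrightarrow> hX_nhd \<omega> U"
  shows "\<exists>\<psi>\<in>state_box. is_KMS h \<beta> \<psi> \<and> (\<forall>U\<in>N. \<psi> (chi {p. ev p \<in> U}) = 1)"
proof -
  have hX: "\<omega> \<in> hX" using om by (simp add: nuX_def)
  have "\<forall>U\<in>N. \<exists>k. (\<lambda>x. complex_of_real (k x)) \<in> higson \<and> \<omega> (\<lambda>x. of_real (k x)) = 0 \<and>
      (\<forall>p. 0 \<le> k p) \<and> (\<forall>p. ev p \<notin> U \<longrightarrow> 1 \<le> k p)"
    using nhd_separation[OF hX N(2)] by metis
  then obtain k where k: "\<And>U. U \<in> N \<Longrightarrow> (\<lambda>x. complex_of_real (k U x)) \<in> higson"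
    "\<And>U. U \<in> N \<Longrightarrow> \<omega> (\<lambda>x. of_real (k U x)) = 0"
    "\<And>U p. U \<in> N \<Longrightarrow> 0 \<le> k U p" "\<And>U p. U \<in> N \<Longrightarrow> ev p \<notin> U \<Longrightarrow> 1 \<le> k U p"
    by metis
  define l where "l x = (\<Sum>U\<in>N. k U x)" for x
  have l: "(\<lambda>x. complex_of_real (l x)) \<in> higson" "\<omega> (\<lambda>x. of_real (l x)) = 0"
    unfolding l_def of_real_sum using higson_sum[of N "\<lambda>U x. complex_of_real (k U x)"] k(1,2)
      hX_sum[OF hX, of N "\<lambda>U x. complex_of_real (k U x)"] by simp_all
  have l1: "1 \<le> l p" if "U \<in> N" "ev p \<notin> U" for U p
    using k(4)[OF that] member_le_sum[of U N "\<lambda>U. k U p"] that(1) N(1) k(3) by (force simp: l_def)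
  have l0: "0 \<le> l p" for p unfolding l_def by (intro sum_nonneg k(3))
  define m where "m x = min (l x) 1" for x
  \<comment> \<open>Characters are linear and multiplicative, which says nothing directly about
    \<open>min\<close>. So \<omega> of the truncation \<open>m\<close> is found by factoring:
    \<open>m * q = l\<close> with \<open>q\<close> bounded below by 1, hence invertible.\<close>
  define q where "q x = max (l x) 1" for x
  have mh: "(\<lambda>x. complex_of_real (m x)) \<in> higson" and qh: "(\<lambda>x. complex_of_real (q x)) \<in> higson"
    unfolding m_def q_def
    using higson_cont[OF l(1), of "\<lambda>z. of_real (min (Re z) 1)"] higson_cont[OF l(1), of "\<lambda>z. of_real (max (Re z) 1)"]
    by (simp_all add: continuous_intros)
  have "m x * q x = l x" for x by (auto simp: m_def q_def min_def max_def)
  then have "\<omega> (\<lambda>x. of_real (m x)) * \<omega> (\<lambda>x. of_real (q x)) = 0"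
    using hX_mult[OF hX mh qh] l(2) by (simp flip: of_real_mult)
  moreover have "\<omega> (\<lambda>x. of_real (q x)) \<noteq> 0"
    by (rule hX_nonzero[OF hX qh, of 1]) (auto simp: q_def)
  ultimately have m0: "\<omega> (\<lambda>x. of_real (m x)) = 0" by simp
  define g where "g x = 1 - m x" for x
  have gh: "(\<lambda>x. complex_of_real (g x)) \<in> higson" and g1: "\<omega> (\<lambda>x. of_real (g x)) = 1"
    using higson_add[OF higson_const[of 1] higson_scale[OF mh, of "-1"]]
      hX_add[OF hX higson_const[of 1] higson_scale[OF mh, of "-1"]] hX_scale[OF hX mh, of "-1"] hX_const[OF hX, of 1] m0
    by (simp_all add: g_def)
  define \<Phi> where "\<Phi> a = \<phi> (mat_of a)" for a
  have bkms: "bKMS h \<beta> \<Phi>" using kms unfolding is_KMS_iff \<Phi>_def .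
  have van': "\<And>k. k \<in> Cpt \<Longrightarrow> \<Phi> k = 0"
    using van unfolding vanishes_on_compacts_def \<Phi>_def compacts_iff[symmetric] by blast
  define f where "f x = complex_of_real (g x * g x)" for x
  have f: "f \<in> higson" using higson_mult[OF gh gh] by (simp add: f_def[abs_def])
  have ch_f: "\<eta> f = \<eta> (\<lambda>x. of_real (g x)) * \<eta> (\<lambda>x. of_real (g x))" if "\<eta> \<in> hX" for \<eta>
    using hX_mult[OF that gh gh] by (simp add: f_def[abs_def])
  define D where "D = dg f"
  have D: "D \<in> Roe" unfolding D_def by (rule dg_Roe[OF higson_bounded[OF f]])
  \<comment> \<open>Faithfulness applies because \<open>f\<close> is the square of a real function,
    hence nonnegative at each corona character, while its value at \<omega> is 1.\<close>
  have nz: "\<Phi> D \<noteq> 0"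
  proof
    assume "\<Phi> D = 0"
    then have "\<phi> (diag f) = 0" by (simp add: \<Phi>_def D_def mat_of_dg higson_bounded f)
    moreover have "\<eta> f \<in> \<real> \<and> 0 \<le> Re (\<eta> f)" if "\<eta> \<in> nuX" for \<eta>
    proof -
      have \<eta>: "\<eta> \<in> hX" using that by (simp add: nuX_def)
      have "Im (\<eta> (\<lambda>x. of_real (g x))) = 0" using hX_real[OF \<eta> gh] by (simp add: complex_is_Real_iff)
      then show ?thesis by (simp add: ch_f[OF \<eta>] complex_is_Real_iff)
    qed
    ultimately have "\<omega> f = 0" using faithful f om unfolding faithful_on_CnuX_def by blast
    then show False by (simp add: ch_f[OF hX] g1)
  qed
  have "bKMS h \<beta> (\<lambda>a. \<Phi> (D * a) / \<Phi> D)"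
    using bKMS_reweight[OF ulf bkms van' gh] nz unfolding D_def f_def by blast
  note \<Psi> = this
  define \<psi> where "\<psi> a = (if a \<in> roe then \<Phi> (D * Bop a) / \<Phi> D else 0)" for a
  have \<psi>: "\<psi> (mat_of a) = \<Phi> (D * a) / \<Phi> D" if "a \<in> Roe" for a
    using that by (simp add: \<psi>_def roe_iff mat_of_inverse)
  have "is_KMS h \<beta> \<psi>" unfolding is_KMS_iff by (rule bKMS_cong[OF \<Psi>]) (rule \<psi>)
  moreover have "\<psi> \<in> state_box"
  proof -
    have "cmod (\<psi> a) \<le> opnorm a" if "a \<in> roe" for a
    proof -
      from that obtain c where c: "c \<in> Roe" "a = mat_of c" unfolding roe_eq by blast
      show ?thesis
        using bstate_norm_le[OF conjunct1[OF \<Psi>[unfolded bKMS_def]] c(1)]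
        by (simp add: c \<psi> norm_bop.rep_eq)
    qed
    then show ?thesis by (auto simp: state_box_def \<psi>_def)
  qed
  moreover have "\<psi> (chi {p. ev p \<in> U}) = 1" if U: "U \<in> N" for U
  proof -
    define A where "A = {p. ev p \<in> U}"
    define c where "c p = complex_of_real (if p \<in> A then 1 else 0)" for p
    have bc: "bounded (range c)" unfolding c_def[abs_def] by (rule bounded_range_of_real[of _ 1]) simp
    \<comment> \<open>\<open>f\<close> vanishes at each point whose evaluation lies outside
      \<open>U\<close>, so the value on \<open>chi\<close> is exactly 1, a condition that survives
      limits.\<close>
    have "(\<lambda>x. f x * c x) = f"
    proof
      fix x show "f x * c x = f x"
        using l1[OF U, of x] by (auto simp: f_def c_def g_def m_def A_def)
    qed
    then have "D * dg c = D" unfolding D_def by (simp flip: dg_mult[OF higson_bounded[OF f] bc])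
    then have "\<psi> (mat_of (dg c)) = 1" using nz by (simp add: \<psi>[OF dg_Roe[OF bc]])
    then show ?thesis unfolding c_def[abs_def] mat_of_chi A_def .
  qed
  ultimately show ?thesis by blast
qed

text \<open>Finite intersection property for the closed sets \<open>K U\<close> in the compact box;
  a point common to all of them is the required state.\<close>

lemma supported_KMS_exists:
  fixes \<phi> :: "'a::metric_space mat \<Rightarrow> complex"
  assumes "ulf TYPE('a)" "is_KMS h \<beta> \<phi>" "vanishes_on_compacts \<phi>" "faithful_on_CnuX \<phi>" "\<omega> \<in> nuX"
  shows "\<exists>\<psi>. is_KMS h \<beta> \<psi> \<and> supported_on \<psi> \<omega>"
proof -
  define K where "K U = {\<psi> :: 'a mat \<Rightarrow> complex. is_KMS h \<beta> \<psi> \<and> \<psi> (chi {p. ev p \<in> U}) = 1}" for U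
  have "state_box \<inter> \<Inter> (K ` {U. hX_nhd \<omega> U}) \<noteq> {}"
  proof (rule compact_imp_fip_image[OF compact_state_box])
    show "closed (K U)" for U
      unfolding K_def
      by (intro closed_Collect_conj closed_KMS closed_Collect_eq continuous_intros continuous_on_product_coordinates)
    fix N assume N: "finite N" "N \<subseteq> {U. hX_nhd \<omega> U}"
    then show "state_box \<inter> \<Inter> (K ` N) \<noteq> {}"
      using localized_KMS[OF assms N(1)] unfolding K_def by fastforce
  qed
  then obtain \<psi> where \<psi>: "\<And>U. hX_nhd \<omega> U \<Longrightarrow> \<psi> \<in> K U" by blast
  \<comment> \<open>At least one neighbourhood must exist for membership in the sets
    \<open>K U\<close> to yield that \<psi> is KMS.\<close>
  moreover have "hX_nhd \<omega> hX" unfolding hX_nhd_def by (auto intro!: exI[of _ "{}"] exI[of _ 1])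
  ultimately show ?thesis unfolding supported_on_def K_def by blast
qed

theorem theorem1p11:
  fixes h :: "'a::metric_space \<Rightarrow> real" and \<beta> :: real
  assumes "ulf TYPE('a)" and "coarse h"
  shows "(\<forall>\<phi>. is_extreme_KMS h \<beta> \<phi> \<and> vanishes_on_compacts \<phi> \<longrightarrow>
            (\<exists>\<omega>\<in>nuX. supported_on \<phi> \<omega>))
       \<and> ((\<exists>\<phi>. is_KMS h \<beta> \<phi> \<and> vanishes_on_compacts \<phi> \<and> faithful_on_CnuX \<phi>) \<longrightarrow>
            (\<forall>\<omega>\<in>(nuX::(('a \<Rightarrow> complex) \<Rightarrow> complex) set). \<exists>\<phi>. is_KMS h \<beta> \<phi> \<and> supported_on \<phi> \<omega>))"
  using extreme_supported[OF assms(1)] supported_KMS_exists[OF assms(1)] by blast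

end
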